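(* Let $n \in \mathbb{N}$, let $M,N : \mathbf{R}^n \to \mathbf{vec}$ be persistence modules, and let $P_\bullet \to M$ and $Q_\bullet \to N$ be projective resolutions of finite length. Let $\epsilon \geq 0$. If $M$ and $N$ are $\epsilon$-interleaved, then so are $$P_0 \oplus Q_1[\epsilon] \oplus P_2[2\epsilon] \oplus Q_3[3\epsilon] \oplus \cdots \quad\text{and}\quad Q_0 \oplus P_1[\epsilon] \oplus Q_2[2\epsilon] \oplus P_3[3\epsilon] \oplus \cdots.$$
   Context: Fix a field $\mathbb{k}$. $\mathbf{vec}$ is the category of finite-dimensional $\mathbb{k}$-vector spaces. $\mathbf{R}^n$ is the set $\mathbb{R}^n$ with the product order, viewed as a category. An ($n$-parameter) persistence module is a functor $\mathbf{R}^n \to \mathbf{vec}$; morphisms are natural transformations, and these form an abelian category, in which projective objects and projective resolutions are taken. A resolution has finite length if $P_m = 0$ for all sufficiently large $m$. For real $\epsilon \geq 0$, the $\epsilon$-shift of $M$ is $M[\epsilon](r) = M(r+(\epsilon,\dots,\epsilon))$ with the evident structure maps (functorial in $M$), and $\iota^M_\epsilon : M \to M[\epsilon]$ is the natural transformation given by the structure maps of $M$. $M$ and $N$ are $\epsilon$-interleaved if there are natural transformations $f : M \to N[\epsilon]$ and $g : N \to M[\epsilon]$ with $g[\epsilon]\circ f = \iota^M_{2\epsilon}$ and $f[\epsilon]\circ g = \iota^N_{2\epsilon}$. *)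

theory Defs
  imports "Jordan_Normal_Form.Matrix" "HOL-Library.Function_Algebras"
begin

text \<open>
  Points of \<open>R^n\<close> are the elements of \<^term>\<open>carrier_vec n\<close>; the order on \<^typ>\<open>real vec\<close> is the
  product order. The field is the type \<open>'k\<close>.

  The vector spaces \<open>M(r)\<close> of a persistence module are finite-dimensional subspaces \<open>fib M r\<close> of one
  ambient vector space, the type \<open>'v\<close> with scalar multiplication \<open>scl M\<close>. The ambient
  space is arbitrary and need not be finite-dimensional, so up to natural isomorphism
  every functor from \<open>R^n\<close> to finite-dimensional vector spaces has this form (take the direct sum of
  all \<open>M(r)\<close> as ambient space). The structure map from \<open>M(r)\<close> to \<open>M(s)\<close> is \<open>tr M r s\<close>. Values of
  \<open>fib\<close>, \<open>tr\<close> and of morphisms outside the relevant points, pairs \<open>r \<le> s\<close> and subspaces carry no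
  meaning and are never compared.
\<close>

record ('k, 'v) persmod =
  scl :: "'k \<Rightarrow> 'v \<Rightarrow> 'v"
  fib :: "real vec \<Rightarrow> 'v set"
  tr :: "real vec \<Rightarrow> real vec \<Rightarrow> 'v \<Rightarrow> 'v"

definition fd_subspace :: "('k::field \<Rightarrow> 'v::ab_group_add \<Rightarrow> 'v) \<Rightarrow> 'v set \<Rightarrow> bool" where
  "fd_subspace s V \<longleftrightarrow> Modules.module.subspace s V \<and> (\<exists>B. finite B \<and> V = Modules.module.span s B)"

definition linear_between ::
  "('k::field \<Rightarrow> 'v::ab_group_add \<Rightarrow> 'v) \<Rightarrow> 'v set \<Rightarrow> ('k \<Rightarrow> 'w::ab_group_add \<Rightarrow> 'w) \<Rightarrow> 'w set \<Rightarrow>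
    ('v \<Rightarrow> 'w) \<Rightarrow> bool" where
  "linear_between s V t W f \<longleftrightarrow>
    (\<forall>x\<in>V. f x \<in> W) \<and>
    (\<forall>x\<in>V. \<forall>y\<in>V. f (x + y) = f x + f y) \<and>
    (\<forall>c. \<forall>x\<in>V. f (s c x) = t c (f x))"

definition persistence_module :: "nat \<Rightarrow> ('k::field, 'v::ab_group_add) persmod \<Rightarrow> bool" where
  "persistence_module n M \<longleftrightarrow>
    vector_space (scl M) \<and>
    (\<forall>r\<in>carrier_vec n. fd_subspace (scl M) (fib M r)) \<and>
    (\<forall>r\<in>carrier_vec n. \<forall>s\<in>carrier_vec n. r \<le> s \<longrightarrow>
      linear_between (scl M) (fib M r) (scl M) (fib M s) (tr M r s)) \<and>
    (\<forall>r\<in>carrier_vec n. \<forall>x\<in>fib M r. tr M r r x = x) \<and>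
    (\<forall>r\<in>carrier_vec n. \<forall>s\<in>carrier_vec n. \<forall>t\<in>carrier_vec n. r \<le> s \<longrightarrow> s \<le> t \<longrightarrow>
      (\<forall>x\<in>fib M r. tr M s t (tr M r s x) = tr M r t x))"

definition pm_hom ::
  "nat \<Rightarrow> ('k::field, 'v::ab_group_add) persmod \<Rightarrow> ('k, 'w::ab_group_add) persmod \<Rightarrow>
    (real vec \<Rightarrow> 'v \<Rightarrow> 'w) \<Rightarrow> bool" where
  "pm_hom n M N f \<longleftrightarrow>
    persistence_module n M \<and> persistence_module n N \<and>
    (\<forall>r\<in>carrier_vec n. linear_between (scl M) (fib M r) (scl N) (fib N r) (f r)) \<and>
    (\<forall>r\<in>carrier_vec n. \<forall>s\<in>carrier_vec n. r \<le> s \<longrightarrow>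
      (\<forall>x\<in>fib M r. f s (tr M r s x) = tr N r s (f r x)))"

definition pm_eq ::
  "nat \<Rightarrow> ('k, 'v) persmod \<Rightarrow> (real vec \<Rightarrow> 'v \<Rightarrow> 'w) \<Rightarrow> (real vec \<Rightarrow> 'v \<Rightarrow> 'w) \<Rightarrow> bool" where
  "pm_eq n M f g \<longleftrightarrow> (\<forall>r\<in>carrier_vec n. \<forall>x\<in>fib M r. f r x = g r x)"

definition pm_comp ::
  "(real vec \<Rightarrow> 'w \<Rightarrow> 'u) \<Rightarrow> (real vec \<Rightarrow> 'v \<Rightarrow> 'w) \<Rightarrow> real vec \<Rightarrow> 'v \<Rightarrow> 'u" where
  "pm_comp g f = (\<lambda>r x. g r (f r x))"

text \<open>
  A predicate cannot quantify over all types, so the test objects in the next two definitions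
  take the ambient type \<^typ>\<open>nat \<Rightarrow> 'k\<close>. This loses nothing: every finite-dimensional
  \<open>'k\<close>-vector space is isomorphic to a subspace of it, hence every persistence module is isomorphic
  to one with this ambient type.
\<close>

definition pm_epi ::
  "nat \<Rightarrow> ('k::field, 'v::ab_group_add) persmod \<Rightarrow> ('k, 'w::ab_group_add) persmod \<Rightarrow>
    (real vec \<Rightarrow> 'v \<Rightarrow> 'w) \<Rightarrow> bool" where
  "pm_epi n M N e \<longleftrightarrow>
    pm_hom n M N e \<and>
    (\<forall>(C :: ('k, nat \<Rightarrow> 'k) persmod) g h.
      pm_hom n N C g \<longrightarrow> pm_hom n N C h \<longrightarrow>
      pm_eq n M (pm_comp g e) (pm_comp h e) \<longrightarrow> pm_eq n N g h)"

definition pm_projective :: "nat \<Rightarrow> ('k::field, 'v::ab_group_add) persmod \<Rightarrow> bool" where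
  "pm_projective n P \<longleftrightarrow>
    persistence_module n P \<and>
    (\<forall>(E :: ('k, nat \<Rightarrow> 'k) persmod) (B :: ('k, nat \<Rightarrow> 'k) persmod) e f.
      pm_epi n E B e \<longrightarrow> pm_hom n P B f \<longrightarrow>
      (\<exists>g. pm_hom n P E g \<and> pm_eq n P (pm_comp e g) f))"

text \<open>
  Here \<open>d i\<close> is the differential from \<open>P (i + 1)\<close> to \<open>P i\<close> and \<open>a\<close> is the augmentation from \<open>P 0\<close>
  to \<open>M\<close>; kernels and images of natural transformations are computed pointwise.
\<close>

definition projective_resolution ::
  "nat \<Rightarrow> (nat \<Rightarrow> ('k::field, 'v::ab_group_add) persmod) \<Rightarrow> (nat \<Rightarrow> real vec \<Rightarrow> 'v \<Rightarrow> 'v) \<Rightarrow>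
    (real vec \<Rightarrow> 'v \<Rightarrow> 'w) \<Rightarrow> ('k, 'w::ab_group_add) persmod \<Rightarrow> bool" where
  "projective_resolution n P d a M \<longleftrightarrow>
    (\<forall>i. pm_projective n (P i)) \<and>
    (\<forall>i. pm_hom n (P (Suc i)) (P i) (d i)) \<and>
    pm_hom n (P 0) M a \<and>
    (\<forall>r\<in>carrier_vec n.
      a r ` fib (P 0) r = fib M r \<and>
      d 0 r ` fib (P 1) r = {x \<in> fib (P 0) r. a r x = 0} \<and>
      (\<forall>i. d (Suc i) r ` fib (P (Suc (Suc i))) r = {x \<in> fib (P (Suc i)) r. d i r x = 0}))"

definition finite_length :: "nat \<Rightarrow> (nat \<Rightarrow> ('k, 'v::zero) persmod) \<Rightarrow> bool" where
  "finite_length n P \<longleftrightarrow> (\<exists>l. \<forall>m\<ge>l. \<forall>r\<in>carrier_vec n. fib (P m) r = {0})"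

definition translate :: "nat \<Rightarrow> real \<Rightarrow> real vec \<Rightarrow> real vec" where
  "translate n \<epsilon> r = r + vec n (\<lambda>_. \<epsilon>)"

definition shift :: "nat \<Rightarrow> real \<Rightarrow> ('k, 'v) persmod \<Rightarrow> ('k, 'v) persmod" where
  "shift n \<epsilon> M =
    \<lparr>scl = scl M,
     fib = (\<lambda>r. fib M (translate n \<epsilon> r)),
     tr = (\<lambda>r s. tr M (translate n \<epsilon> r) (translate n \<epsilon> s))\<rparr>"

definition shift_hom :: "nat \<Rightarrow> real \<Rightarrow> (real vec \<Rightarrow> 'v \<Rightarrow> 'w) \<Rightarrow> real vec \<Rightarrow> 'v \<Rightarrow> 'w" where
  "shift_hom n \<epsilon> f = (\<lambda>r. f (translate n \<epsilon> r))"

definition shift_unit :: "nat \<Rightarrow> real \<Rightarrow> ('k, 'v) persmod \<Rightarrow> real vec \<Rightarrow> 'v \<Rightarrow> 'v" where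
  "shift_unit n \<epsilon> M = (\<lambda>r. tr M r (translate n \<epsilon> r))"

definition interleaved ::
  "nat \<Rightarrow> real \<Rightarrow> ('k::field, 'v::ab_group_add) persmod \<Rightarrow> ('k, 'w::ab_group_add) persmod \<Rightarrow> bool"
  where
  "interleaved n \<epsilon> M N \<longleftrightarrow>
    persistence_module n M \<and> persistence_module n N \<and>
    (\<exists>f g. pm_hom n M (shift n \<epsilon> N) f \<and> pm_hom n N (shift n \<epsilon> M) g \<and>
      pm_eq n M (pm_comp (shift_hom n \<epsilon> g) f) (shift_unit n (2 * \<epsilon>) M) \<and>
      pm_eq n N (pm_comp (shift_hom n \<epsilon> f) g) (shift_unit n (2 * \<epsilon>) N))"

text \<open>
  The addition on \<^typ>\<open>nat \<Rightarrow> 'v\<close> is the pointwise one. The direct sum consists of the families with finite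
  support; it is a persistence module only if its spaces are finite-dimensional, for
  instance if all but finitely many summands vanish.
\<close>

definition direct_sum ::
  "(nat \<Rightarrow> ('k, 'v::zero) persmod) \<Rightarrow> ('k, nat \<Rightarrow> 'v) persmod" where
  "direct_sum M =
    \<lparr>scl = (\<lambda>c x i. scl (M i) c (x i)),
     fib = (\<lambda>r. {x. (\<forall>i. x i \<in> fib (M i) r) \<and> finite {i. x i \<noteq> 0}}),
     tr = (\<lambda>r s x i. tr (M i) r s (x i))\<rparr>"

end

theory Submission
  imports Defs
begin

text \<open>
  Write \<open>A i\<close> and \<open>B i\<close> for the summands in degree \<open>i\<close> of the two direct sums. The differentials of
  the two resolutions are exchanged by this regrouping: in every degree, \<open>A (i + 1)\<close> and
  \<open>B i\<close> belong to the same resolution, and since \<open>A (i + 1)\<close> carries one more shift by \<open>\<epsilon>\<close> than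
  \<open>B i\<close>, the differential becomes a natural transformation from \<open>A (i + 1)\<close> to \<open>B i\<close> shifted by \<open>\<epsilon>\<close>,
  which is the shape of one half of an interleaving. The locale \<open>crossed_resolutions\<close> records
  these data.

  The proof is a form of Schanuel's lemma, iterated along the resolutions. Let
  \<open>X k = A 0 \<oplus> \<dots> \<oplus> A k\<close> and \<open>Y k = B 0 \<oplus> \<dots> \<oplus> B k\<close>, and let \<open>ZA k \<subseteq> A k\<close> and \<open>ZB k \<subseteq> B k\<close> be the
  cycles. By induction on \<open>k\<close> there are \<open>F\<close> from \<open>X k\<close> to the shift of \<open>Y k\<close> and \<open>G\<close> from \<open>Y k\<close> to
  the shift of \<open>X k\<close> that respect the cycles in degree \<open>k\<close> and whose composites are the structure
  maps up to such cycles; in other words, the quotients of \<open>X k\<close> and \<open>Y k\<close> by the cycles are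
  interleaved by maps that lift (\<open>round_trip_modulo\<close>).

  For \<open>k = 0\<close> the quotients are isomorphic to \<open>M\<close> and \<open>N\<close>, and projectivity lifts their interleaving
  (\<open>lift_to_first_summands\<close>, \<open>round_trip_first_summands\<close>).

  For the step, map \<open>(x, a)\<close> in \<open>X k \<oplus> A (k + 1)\<close> to \<open>y = F x + d a\<close>. The element
  \<open>\<iota> x - G y\<close>, where \<open>\<iota>\<close> denotes the structure map over \<open>2\<epsilon>\<close>, is a cycle of \<open>A k\<close>, because
  \<open>\<iota> x - G (F x)\<close> is one and \<open>G\<close> sends the cycle \<open>d a\<close> to one. By exactness it is a
  boundary, and as \<open>X (k + 1)\<close> is projective it equals \<open>d (\<eta> (x, a))\<close> for some natural \<open>\<eta>\<close> with
  values in \<open>B (k + 1)\<close> (\<open>lift_next_component\<close>). The next map is \<open>(x, a) \<mapsto> (y, \<eta> (x, a))\<close>. Going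
  back the same way gives \<open>G y + d (\<eta> (x, a)) = \<iota> x\<close> in the degrees up to \<open>k\<close>, so that the
  composite deviates from the structure map only in degree \<open>k + 1\<close>, and there by a cycle
  (\<open>round_trip_next\<close>).

  Since both resolutions have finite length, the cycles vanish in high degrees, and the maps modulo
  cycles are an interleaving of the whole direct sums.
\<close>

section \<open>Shifts and direct sums\<close>

lemma translate_carrier [simp]: "r \<in> carrier_vec n \<Longrightarrow> translate n a r \<in> carrier_vec n"
  by (simp add: translate_def)

lemma translate_mono:
  "r \<in> carrier_vec n \<Longrightarrow> s \<in> carrier_vec n \<Longrightarrow> r \<le> s \<Longrightarrow> translate n a r \<le> translate n a s"
  by (auto simp: translate_def less_eq_vec_def)

lemma le_translate: "r \<in> carrier_vec n \<Longrightarrow> 0 \<le> a \<Longrightarrow> r \<le> translate n a r"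
  by (auto simp: translate_def less_eq_vec_def)

lemma translate_zero [simp]: "r \<in> carrier_vec n \<Longrightarrow> translate n 0 r = r"
  by (rule eq_vecI) (auto simp: translate_def)

lemma translate_translate [simp]: "translate n a (translate n b r) = translate n (a + b) r"
  by (rule eq_vecI) (auto simp: translate_def)

lemma shift_simps [simp]:
  "scl (shift n a M) = scl M"
  "fib (shift n a M) r = fib M (translate n a r)"
  "tr (shift n a M) r s = tr M (translate n a r) (translate n a s)"
  by (simp_all add: shift_def)

text \<open>
  Successive shifts compose to an equal record, whereas the shift by \<open>0\<close> agrees with \<open>M\<close>
  only at points of \<open>R^n\<close>: vectors of another dimension are cut or extended by \<^const>\<open>translate\<close>.
\<close>
lemma shift_shift: "shift n a (shift n b M) = shift n (a + b) M"
  by (simp add: shift_def add.commute)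

lemma direct_sum_simps [simp]:
  "scl (direct_sum M) = (\<lambda>c x i. scl (M i) c (x i))"
  "fib (direct_sum M) r = {x. (\<forall>i. x i \<in> fib (M i) r) \<and> finite {i. x i \<noteq> 0}}"
  "tr (direct_sum M) r s = (\<lambda>x i. tr (M i) r s (x i))"
  by (simp_all add: direct_sum_def)

section \<open>Finite-dimensional subspaces\<close>

lemma fd_subspace_closed:
  assumes "vector_space s" "fd_subspace s V"
  shows "0 \<in> V" and "x \<in> V \<Longrightarrow> y \<in> V \<Longrightarrow> x + y \<in> V"
    and "x \<in> V \<Longrightarrow> y \<in> V \<Longrightarrow> x - y \<in> V" and "x \<in> V \<Longrightarrow> s c x \<in> V"
proof -
  interpret vector_space s by fact
  have "subspace V" using assms(2) by (simp add: fd_subspace_def)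
  then show "0 \<in> V" and "x \<in> V \<Longrightarrow> y \<in> V \<Longrightarrow> x + y \<in> V"
    and "x \<in> V \<Longrightarrow> y \<in> V \<Longrightarrow> x - y \<in> V" and "x \<in> V \<Longrightarrow> s c x \<in> V"
    by (simp_all add: subspace_0 subspace_add subspace_diff subspace_scale)
qed

lemma linear_between_closed:
  assumes "vector_space s" "fd_subspace s V" "linear_between s V t W f"
  shows "f 0 = 0" and "x \<in> V \<Longrightarrow> y \<in> V \<Longrightarrow> f (x - y) = f x - f y"
proof -
  note V = fd_subspace_closed[OF assms(1,2)]
  have add: "f (x + y) = f x + f y" if "x \<in> V" "y \<in> V" for x y
    using that assms(3) by (simp add: linear_between_def)
  show "f 0 = 0" using add[of 0 0] V(1) by simp
  show "f (x - y) = f x - f y" if "x \<in> V" "y \<in> V"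
    using add[of "x - y" y] V(3) that by (simp add: algebra_simps)
qed

lemma fd_subspace_image:
  assumes "vector_space s" "vector_space t" "fd_subspace s V" "linear_between s V t W f"
  shows "fd_subspace t (f ` V)"
proof -
  interpret s: vector_space s by fact
  interpret t: vector_space t by fact
  from assms(3) obtain B where V: "s.subspace V" and B: "finite B" "V = s.span B"
    by (auto simp: fd_subspace_def)
  have add: "f (x + y) = f x + f y" and scl: "f (s c x) = t c (f x)"
    if "x \<in> V" "y \<in> V" for x y c
    using that assms(4) by (auto simp: linear_between_def)
  have zero: "f 0 = 0" by (rule linear_between_closed(1)[OF assms(1,3,4)])
  have sub: "t.subspace (f ` V)"
  proof (rule t.subspaceI)
    show "0 \<in> f ` V" using zero s.subspace_0[OF V] by force
    show "x + y \<in> f ` V" if "x \<in> f ` V" "y \<in> f ` V" for x y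
      using that s.subspace_add[OF V] by (auto simp: add[symmetric])
    show "t c x \<in> f ` V" if "x \<in> f ` V" for c x
      using that s.subspace_scale[OF V] by (auto simp: scl[symmetric])
  qed
  have "f x \<in> t.span (f ` B) \<and> x \<in> V" if "x \<in> s.span B" for x
    using that
  proof (induction rule: s.span_induct_alt)
    case base
    then show ?case using zero s.subspace_0[OF V] t.span_zero by simp
  next
    case (step c x y)
    have x: "x \<in> V" using step B s.span_base by auto
    then have "s c x \<in> V" using V by (simp add: s.subspace_scale)
    then show ?case
      using step x add scl V
      by (simp add: s.subspace_add t.span_add t.span_scale t.span_base)
  qed
  then have "f ` V \<subseteq> t.span (f ` B)" using B by auto
  moreover have "t.span (f ` B) \<subseteq> f ` V"
    using B by (intro t.span_minimal sub) (auto intro: s.span_base)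
  ultimately show ?thesis
    using sub B unfolding fd_subspace_def by blast
qed

lemma vector_space_pointwise:
  assumes "\<And>i. vector_space (S i)"
  shows "vector_space (\<lambda>c x i. S i c (x i))"
proof -
  have [simp]: "S i c (x + y) = S i c x + S i c y" "S i (c + d) x = S i c x + S i d x"
    "S i c (S i d x) = S i (c * d) x" "S i 1 x = x" for i c d x y
    using assms[of i] by (auto simp: vector_space_def)
  show ?thesis by unfold_locales auto
qed

text \<open>
  Choosing a basis moves a finite-dimensional space into the one ambient type that the test objects
  of \<^const>\<open>pm_projective\<close> have. The space of coordinate vectors is taken to be the image of the
  coordinate map, so that one of the two inverse laws and finite dimension come for free.
\<close>
lemma fd_subspace_coordinates:
  fixes s :: "'k::field \<Rightarrow> 'v::ab_group_add \<Rightarrow> 'v"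
  assumes "vector_space s" "fd_subspace s V"
  shows "\<exists>(V' :: (nat \<Rightarrow> 'k) set) \<phi> \<psi>. fd_subspace (\<lambda>c x i. c * x i) V' \<and>
    linear_between s V (\<lambda>c x i. c * x i) V' \<phi> \<and> linear_between (\<lambda>c x i. c * x i) V' s V \<psi> \<and>
    (\<forall>x\<in>V. \<psi> (\<phi> x) = x) \<and> (\<forall>y\<in>V'. \<phi> (\<psi> y) = y)"
proof -
  interpret vector_space s by fact
  have pw: "vector_space (\<lambda>c (x :: nat \<Rightarrow> 'k) i. c * x i)"
    by (rule vector_space_pointwise) (unfold_locales, auto simp: algebra_simps)
  from assms(2) obtain B0 where B0: "finite B0" "V = span B0"
    by (auto simp: fd_subspace_def)
  obtain B where B: "B \<subseteq> B0" "independent B" "B0 \<subseteq> span B"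
    using maximal_independent_subset .
  have fin: "finite B" using B B0 finite_subset by auto
  have V: "V = span B"
    using B B0 by (metis span_mono span_minimal subspace_span subset_antisym)
  obtain h where h: "bij_betw h {0..<card B} B"
    using ex_bij_betw_nat_finite[OF fin] by auto
  let ?\<phi> = "\<lambda>x i. if i < card B then representation B x (h i) else 0"
  let ?\<psi> = "\<lambda>y. \<Sum>i<card B. s (y i) (h i)"
  have inv: "?\<psi> (?\<phi> x) = x" if "x \<in> V" for x
  proof -
    have "?\<psi> (?\<phi> x) = (\<Sum>i\<in>{0..<card B}. s (representation B x (h i)) (h i))"
      by (rule sum.cong) auto
    also have "\<dots> = (\<Sum>b\<in>B. s (representation B x b) b)"
      by (rule sum.reindex_bij_betw[OF h])
    also have "\<dots> = x"
      using that V fin B by (intro sum_representation_eq) auto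
    finally show ?thesis .
  qed
  have lin: "linear_between s V (\<lambda>c x i. c * x i) (?\<phi> ` V) ?\<phi>"
    using V B by (auto simp: linear_between_def representation_add representation_scale fun_eq_iff)
  have "linear_between (\<lambda>c x i. c * x i) (?\<phi> ` V) s V ?\<psi>"
    unfolding linear_between_def
    by (auto simp: inv[simplified] scale_left_distrib sum.distrib scale_sum_right)
  moreover have "fd_subspace (\<lambda>c x i. c * x i) (?\<phi> ` V)"
    by (rule fd_subspace_image[OF assms(1) pw assms(2) lin])
  ultimately show ?thesis
    using lin inv by (intro exI[of _ "?\<phi> ` V"] exI[of _ ?\<phi>] exI[of _ ?\<psi>]) auto
qed

section \<open>Persistence modules and natural transformations\<close>

context
  fixes n :: nat and M :: "('k::field, 'v::ab_group_add) persmod"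
  assumes pm: "persistence_module n M"
begin

lemma pm_vector_space: "vector_space (scl M)"
  using pm by (simp add: persistence_module_def)

lemma pm_fd: "r \<in> carrier_vec n \<Longrightarrow> fd_subspace (scl M) (fib M r)"
  using pm by (simp add: persistence_module_def)

lemmas fib_zero = fd_subspace_closed(1)[OF pm_vector_space pm_fd]
lemmas fib_add = fd_subspace_closed(2)[OF pm_vector_space pm_fd]
lemmas fib_diff = fd_subspace_closed(3)[OF pm_vector_space pm_fd]
lemmas fib_scl = fd_subspace_closed(4)[OF pm_vector_space pm_fd]

lemma scl_add: "scl M c (x + y) = scl M c x + scl M c y"
  using pm_vector_space by (simp add: vector_space_def)

lemma scl_zero: "scl M c 0 = 0"
  using scl_add[of c 0 0] by simp

lemma scl_diff: "scl M c (x - y) = scl M c x - scl M c y"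
  using scl_add[of c "x - y" y] by (simp add: algebra_simps)

context
  fixes r s :: "real vec"
  assumes rs: "r \<in> carrier_vec n" "s \<in> carrier_vec n" "r \<le> s"
begin

lemma tr_linear: "linear_between (scl M) (fib M r) (scl M) (fib M s) (tr M r s)"
  using pm rs by (simp add: persistence_module_def)

lemma tr_mem: "x \<in> fib M r \<Longrightarrow> tr M r s x \<in> fib M s"
  and tr_add: "x \<in> fib M r \<Longrightarrow> y \<in> fib M r \<Longrightarrow> tr M r s (x + y) = tr M r s x + tr M r s y"
  and tr_scl: "x \<in> fib M r \<Longrightarrow> tr M r s (scl M c x) = scl M c (tr M r s x)"
  using tr_linear by (simp_all add: linear_between_def)

lemmas tr_zero = linear_between_closed(1)[OF pm_vector_space pm_fd[OF rs(1)] tr_linear]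
lemmas tr_diff = linear_between_closed(2)[OF pm_vector_space pm_fd[OF rs(1)] tr_linear]

end

lemma tr_refl: "r \<in> carrier_vec n \<Longrightarrow> x \<in> fib M r \<Longrightarrow> tr M r r x = x"
  using pm by (simp add: persistence_module_def)

lemma tr_tr:
  "r \<in> carrier_vec n \<Longrightarrow> s \<in> carrier_vec n \<Longrightarrow> t \<in> carrier_vec n \<Longrightarrow> r \<le> s \<Longrightarrow> s \<le> t \<Longrightarrow>
    x \<in> fib M r \<Longrightarrow> tr M s t (tr M r s x) = tr M r t x"
  using pm by (simp add: persistence_module_def)

lemma persistence_module_shift: "persistence_module n (shift n a M)"
  unfolding persistence_module_def
  by (auto simp: pm_vector_space pm_fd tr_refl translate_mono intro: tr_linear tr_tr)

end

context
  fixes n :: nat and M :: "('k::field, 'v::ab_group_add) persmod"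
    and N :: "('k, 'w::ab_group_add) persmod" and f
  assumes hom: "pm_hom n M N f"
begin

lemma pm_hom_dom: "persistence_module n M" and pm_hom_cod: "persistence_module n N"
  using hom by (simp_all add: pm_hom_def)

lemma pm_hom_natural:
  "r \<in> carrier_vec n \<Longrightarrow> s \<in> carrier_vec n \<Longrightarrow> r \<le> s \<Longrightarrow> x \<in> fib M r \<Longrightarrow>
    f s (tr M r s x) = tr N r s (f r x)"
  using hom by (simp add: pm_hom_def)

context
  fixes r :: "real vec"
  assumes r: "r \<in> carrier_vec n"
begin

lemma pm_hom_linear: "linear_between (scl M) (fib M r) (scl N) (fib N r) (f r)"
  using hom r by (simp add: pm_hom_def)

lemma pm_hom_mem: "x \<in> fib M r \<Longrightarrow> f r x \<in> fib N r"
  and pm_hom_add: "x \<in> fib M r \<Longrightarrow> y \<in> fib M r \<Longrightarrow> f r (x + y) = f r x + f r y"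
  and pm_hom_scl: "x \<in> fib M r \<Longrightarrow> f r (scl M c x) = scl N c (f r x)"
  using pm_hom_linear by (simp_all add: linear_between_def)

lemmas pm_hom_zero =
  linear_between_closed(1)[OF pm_vector_space[OF pm_hom_dom] pm_fd[OF pm_hom_dom r] pm_hom_linear]
lemmas pm_hom_diff =
  linear_between_closed(2)[OF pm_vector_space[OF pm_hom_dom] pm_fd[OF pm_hom_dom r] pm_hom_linear]

end

lemma pm_hom_shift: "pm_hom n (shift n a M) (shift n a N) (shift_hom n a f)"
  unfolding pm_hom_def
  by (auto simp: persistence_module_shift pm_hom_dom pm_hom_cod shift_hom_def translate_mono
      pm_hom_natural intro: pm_hom_linear)

end

lemma pm_homI:
  assumes "persistence_module n M" "persistence_module n N"
    and "\<And>r x. r \<in> carrier_vec n \<Longrightarrow> x \<in> fib M r \<Longrightarrow> f r x \<in> fib N r"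
    and "\<And>r x y. r \<in> carrier_vec n \<Longrightarrow> x \<in> fib M r \<Longrightarrow> y \<in> fib M r \<Longrightarrow> f r (x + y) = f r x + f r y"
    and "\<And>r c x. r \<in> carrier_vec n \<Longrightarrow> x \<in> fib M r \<Longrightarrow> f r (scl M c x) = scl N c (f r x)"
    and "\<And>r s x. r \<in> carrier_vec n \<Longrightarrow> s \<in> carrier_vec n \<Longrightarrow> r \<le> s \<Longrightarrow> x \<in> fib M r \<Longrightarrow>
      f s (tr M r s x) = tr N r s (f r x)"
  shows "pm_hom n M N f"
  using assms by (simp add: pm_hom_def linear_between_def)

lemma pm_hom_comp:
  assumes f: "pm_hom n M N f" and g: "pm_hom n N L g"
  shows "pm_hom n M L (pm_comp g f)"
  by (rule pm_homI)
    (simp_all add: pm_comp_def pm_hom_dom[OF f] pm_hom_cod[OF g] pm_hom_mem[OF f] pm_hom_mem[OF g]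
      pm_hom_add[OF f] pm_hom_add[OF g] pm_hom_scl[OF f] pm_hom_scl[OF g] pm_hom_natural[OF f]
      pm_hom_natural[OF g])

lemma pm_hom_plus:
  assumes f: "pm_hom n M N f" and g: "pm_hom n M N g"
  shows "pm_hom n M N (\<lambda>r x. f r x + g r x)"
  by (rule pm_homI)
    (simp_all add: pm_hom_dom[OF f] pm_hom_cod[OF f] fib_add[OF pm_hom_cod[OF f]]
      pm_hom_mem[OF f] pm_hom_mem[OF g] pm_hom_add[OF f] pm_hom_add[OF g] pm_hom_scl[OF f]
      pm_hom_scl[OF g] pm_hom_natural[OF f] pm_hom_natural[OF g] scl_add[OF pm_hom_cod[OF f]]
      tr_add[OF pm_hom_cod[OF f]])

lemma pm_hom_minus:
  assumes f: "pm_hom n M N f" and g: "pm_hom n M N g"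
  shows "pm_hom n M N (\<lambda>r x. f r x - g r x)"
  by (rule pm_homI)
    (simp_all add: pm_hom_dom[OF f] pm_hom_cod[OF f] fib_diff[OF pm_hom_cod[OF f]]
      pm_hom_mem[OF f] pm_hom_mem[OF g] pm_hom_add[OF f] pm_hom_add[OF g] pm_hom_scl[OF f]
      pm_hom_scl[OF g] pm_hom_natural[OF f] pm_hom_natural[OF g] scl_diff[OF pm_hom_cod[OF f]]
      tr_diff[OF pm_hom_cod[OF f]])

lemma pm_hom_tr:
  assumes M: "persistence_module n M" and "0 \<le> a"
  shows "pm_hom n M (shift n a M) (shift_unit n a M)"
proof (rule pm_homI[OF M persistence_module_shift[OF M]])
  note le = le_translate[OF _ \<open>0 \<le> a\<close>]
  show "shift_unit n a M s (tr M r s x) = tr (shift n a M) r s (shift_unit n a M r x)"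
    if "r \<in> carrier_vec n" "s \<in> carrier_vec n" "r \<le> s" "x \<in> fib M r" for r s x
    using that le[of r] le[of s] translate_mono[of r n s a]
    by (simp add: shift_unit_def tr_tr[OF M])
qed (simp_all add: shift_unit_def tr_mem[OF M] tr_add[OF M] tr_scl[OF M] le_translate[OF _ \<open>0 \<le> a\<close>])

text \<open>
  Only the values at points of \<open>R^n\<close> matter, so that modules may be exchanged although they differ as
  records; this is needed for a shift by \<open>0\<close> and for a direct sum that is a partial sum.
\<close>
lemma pm_hom_cong:
  assumes f: "pm_hom n M N f"
    and M: "scl M' = scl M"
      "\<And>r s. r \<in> carrier_vec n \<Longrightarrow> s \<in> carrier_vec n \<Longrightarrow> tr M' r s = tr M r s"
      "\<And>r. r \<in> carrier_vec n \<Longrightarrow> fib M' r = fib M r"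
    and N: "scl N' = scl N"
      "\<And>r s. r \<in> carrier_vec n \<Longrightarrow> s \<in> carrier_vec n \<Longrightarrow> tr N' r s = tr N r s"
      "\<And>r. r \<in> carrier_vec n \<Longrightarrow> fib N' r = fib N r"
  shows "pm_hom n M' N' f"
  using f unfolding pm_hom_def persistence_module_def by (simp add: M N)

section \<open>Lifting from projective persistence modules\<close>

lemma persistence_module_image:
  assumes e: "pm_hom n E B e"
  shows "persistence_module n (B\<lparr>fib := \<lambda>r. e r ` fib E r\<rparr>)" (is "persistence_module n ?I")
  unfolding persistence_module_def
proof (intro conjI ballI impI)
  note E = pm_hom_dom[OF e] and B = pm_hom_cod[OF e]
  show "vector_space (scl ?I)"
    by (simp add: pm_vector_space[OF B])
  fix r :: "real vec" assume r: "r \<in> carrier_vec n"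
  show "fd_subspace (scl ?I) (fib ?I r)"
    using fd_subspace_image[OF pm_vector_space[OF E] pm_vector_space[OF B] pm_fd[OF E r]
        pm_hom_linear[OF e r]] by simp
  show "tr ?I r r x = x"
    if "x \<in> fib ?I r" for x
    using that r by (auto simp: tr_refl[OF B] pm_hom_mem[OF e])
  fix s :: "real vec" assume s: "s \<in> carrier_vec n"
  {
    assume rs: "r \<le> s"
    show "linear_between (scl ?I) (fib ?I r)
     (scl ?I) (fib ?I s)
     (tr ?I r s)"
      using r s rs unfolding linear_between_def
      by (auto simp: tr_add[OF B] tr_scl[OF B] pm_hom_mem[OF e] pm_hom_natural[OF e, symmetric]
          intro!: imageI tr_mem[OF E])
    fix t :: "real vec" and x assume "t \<in> carrier_vec n" "s \<le> t"
      "x \<in> fib ?I r"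
    then show "tr ?I s t (tr ?I r s x) =
      tr ?I r t x"
      using r s rs by (auto simp: tr_tr[OF B] pm_hom_mem[OF e])
  }
qed

text \<open>
  Bases are chosen at each point of \<open>R^n\<close> independently; the structure maps are carried over by
  conjugation, which makes the coordinate maps natural.
\<close>
lemma isomorphic_coordinate_module:
  fixes M :: "('k::field, 'v::ab_group_add) persmod"
  assumes M: "persistence_module n M"
  shows "\<exists>(M' :: ('k, nat \<Rightarrow> 'k) persmod) \<phi> \<psi>. pm_hom n M M' \<phi> \<and> pm_hom n M' M \<psi> \<and>
    (\<forall>r\<in>carrier_vec n. \<forall>x\<in>fib M r. \<psi> r (\<phi> r x) = x) \<and>
    (\<forall>r\<in>carrier_vec n. \<forall>y\<in>fib M' r. \<phi> r (\<psi> r y) = y)"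
proof -
  let ?pw = "\<lambda>c (x :: nat \<Rightarrow> 'k) i. c * x i"
  define coords where "coords r V' \<phi> \<psi> \<longleftrightarrow> fd_subspace ?pw V' \<and>
    linear_between (scl M) (fib M r) ?pw V' \<phi> \<and> linear_between ?pw V' (scl M) (fib M r) \<psi> \<and>
    (\<forall>x\<in>fib M r. \<psi> (\<phi> x) = x) \<and> (\<forall>y\<in>V'. \<phi> (\<psi> y) = y)" for r V' \<phi> \<psi>
  have "\<forall>r\<in>carrier_vec n. \<exists>V' \<phi> \<psi>. coords r V' \<phi> \<psi>"
    unfolding coords_def
    using fd_subspace_coordinates[OF pm_vector_space[OF M] pm_fd[OF M]] by blast
  then obtain V' \<phi> \<psi> where "\<forall>r\<in>carrier_vec n. coords r (V' r) (\<phi> r) (\<psi> r)"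
    by metis
  note all = this[unfolded coords_def]
  define M' :: "('k, nat \<Rightarrow> 'k) persmod" where
    "M' = \<lparr>scl = ?pw, fib = V', tr = \<lambda>r s y. \<phi> s (tr M r s (\<psi> r y))\<rparr>"
  have M'_simps: "scl M' = ?pw" "fib M' = V'" "\<And>r s y. tr M' r s y = \<phi> s (tr M r s (\<psi> r y))"
    by (simp_all add: M'_def)
  have [simp]: "\<phi> r x \<in> V' r" "\<phi> r (scl M c x) = ?pw c (\<phi> r x)" "\<psi> r (\<phi> r x) = x"
    if "r \<in> carrier_vec n" "x \<in> fib M r" for r x c
    using all that by (simp_all add: linear_between_def)
  have [simp]: "\<phi> r (x + y) = \<phi> r x + \<phi> r y"
    if "r \<in> carrier_vec n" "x \<in> fib M r" "y \<in> fib M r" for r x y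
    using all that by (simp add: linear_between_def)
  have [simp]: "\<psi> r x \<in> fib M r" "\<psi> r (?pw c x) = scl M c (\<psi> r x)" "\<phi> r (\<psi> r x) = x"
    if "r \<in> carrier_vec n" "x \<in> V' r" for r x c
    using all that by (simp_all add: linear_between_def)
  have [simp]: "\<psi> r (x + y) = \<psi> r x + \<psi> r y"
    if "r \<in> carrier_vec n" "x \<in> V' r" "y \<in> V' r" for r x y
    using all that by (simp add: linear_between_def)
  have "vector_space ?pw"
    by (rule vector_space_pointwise) (unfold_locales, auto simp: algebra_simps)
  then have M': "persistence_module n M'"
    unfolding persistence_module_def linear_between_def M'_simps
    using all by (simp add: tr_mem[OF M] tr_add[OF M] tr_scl[OF M] tr_refl[OF M] tr_tr[OF M])
  have "pm_hom n M M' \<phi>"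
    by (rule pm_homI[OF M M']) (simp_all add: M'_simps tr_mem[OF M])
  moreover have "pm_hom n M' M \<psi>"
    by (rule pm_homI[OF M' M]) (simp_all add: M'_simps tr_mem[OF M])
  ultimately show ?thesis
    using all by (intro exI[of _ M'] exI[of _ \<phi>] exI[of _ \<psi>]) (simp add: M'_simps)
qed

lemma pm_epi_if_surjective:
  assumes "pm_hom n M N e" "\<And>r. r \<in> carrier_vec n \<Longrightarrow> fib N r \<subseteq> e r ` fib M r"
  shows "pm_epi n M N e"
  using assms unfolding pm_epi_def pm_eq_def pm_comp_def by blast

text \<open>
  The form of projectivity that the argument uses: the ambient types of \<open>E\<close> and \<open>B\<close> are arbitrary, and
  \<open>e\<close> need only reach the values of \<open>f\<close>. Replacing \<open>B\<close> by the image of \<open>e\<close> makes \<open>e\<close>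
  surjective, and replacing \<open>E\<close> and the image by isomorphic modules of coordinate vectors turns the
  problem into one to which the definition applies.
\<close>
lemma projective_lift_through_image:
  fixes P :: "('k::field, 'v::ab_group_add) persmod"
    and E :: "('k, 'e::ab_group_add) persmod" and B :: "('k, 'b::ab_group_add) persmod"
  assumes P: "pm_projective n P" and f: "pm_hom n P B f" and e: "pm_hom n E B e"
    and im: "\<And>r x. r \<in> carrier_vec n \<Longrightarrow> x \<in> fib P r \<Longrightarrow> f r x \<in> e r ` fib E r"
  shows "\<exists>g. pm_hom n P E g \<and> (\<forall>r\<in>carrier_vec n. \<forall>x\<in>fib P r. e r (g r x) = f r x)"
proof -
  define I where "I = B\<lparr>fib := \<lambda>r. e r ` fib E r\<rparr>"
  have I_simps: "scl I = scl B" "tr I = tr B" "\<And>r. fib I r = e r ` fib E r"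
    by (simp_all add: I_def)
  have I: "persistence_module n I"
    unfolding I_def by (rule persistence_module_image[OF e])
  have eI: "pm_hom n E I e"
    by (rule pm_homI[OF pm_hom_dom[OF e] I])
      (simp_all add: I_simps pm_hom_add[OF e] pm_hom_scl[OF e] pm_hom_natural[OF e])
  have fI: "pm_hom n P I f"
    by (rule pm_homI[OF pm_hom_dom[OF f] I])
      (simp_all add: I_simps im pm_hom_add[OF f] pm_hom_scl[OF f] pm_hom_natural[OF f])
  obtain E' :: "('k, nat \<Rightarrow> 'k) persmod" and \<phi> \<psi> where
    \<phi>: "pm_hom n E E' \<phi>" and \<psi>: "pm_hom n E' E \<psi>"
    and \<psi>\<phi>: "\<And>r x. r \<in> carrier_vec n \<Longrightarrow> x \<in> fib E r \<Longrightarrow> \<psi> r (\<phi> r x) = x"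
    using isomorphic_coordinate_module[OF pm_hom_dom[OF e]] by blast
  obtain I' :: "('k, nat \<Rightarrow> 'k) persmod" and \<alpha> \<beta> where
    \<alpha>: "pm_hom n I I' \<alpha>" and \<beta>: "pm_hom n I' I \<beta>"
    and \<beta>\<alpha>: "\<And>r x. r \<in> carrier_vec n \<Longrightarrow> x \<in> fib I r \<Longrightarrow> \<beta> r (\<alpha> r x) = x"
    and \<alpha>\<beta>: "\<And>r x. r \<in> carrier_vec n \<Longrightarrow> x \<in> fib I' r \<Longrightarrow> \<alpha> r (\<beta> r x) = x"
    using isomorphic_coordinate_module[OF I] by blast
  let ?e = "pm_comp \<alpha> (pm_comp e \<psi>)"
  have "pm_epi n E' I' ?e"
  proof (rule pm_epi_if_surjective)
    show "pm_hom n E' I' ?e"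
      by (intro pm_hom_comp[OF _ \<alpha>] pm_hom_comp[OF \<psi> eI])
    show "fib I' r \<subseteq> ?e r ` fib E' r" if r: "r \<in> carrier_vec n" for r
    proof
      fix y assume y: "y \<in> fib I' r"
      then have "\<beta> r y \<in> fib I r" using pm_hom_mem[OF \<beta> r] by simp
      then obtain x where x: "x \<in> fib E r" "\<beta> r y = e r x" by (auto simp: I_simps)
      then have "?e r (\<phi> r x) = y" using r y by (simp add: pm_comp_def \<psi>\<phi> \<alpha>\<beta> flip: x(2))
      then show "y \<in> ?e r ` fib E' r" using pm_hom_mem[OF \<phi> r] x(1) by blast
    qed
  qed
  moreover have "pm_hom n P I' (pm_comp \<alpha> f)" by (rule pm_hom_comp[OF fI \<alpha>])
  ultimately obtain g where g: "pm_hom n P E' g" "pm_eq n P (pm_comp ?e g) (pm_comp \<alpha> f)"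
    using P unfolding pm_projective_def by meson
  have "pm_hom n P E (pm_comp \<psi> g)" by (rule pm_hom_comp[OF g(1) \<psi>])
  moreover have "e r (pm_comp \<psi> g r x) = f r x"
    if r: "r \<in> carrier_vec n" and x: "x \<in> fib P r" for r x
  proof -
    have "\<beta> r (\<alpha> r (e r (\<psi> r (g r x)))) = \<beta> r (\<alpha> r (f r x))"
      using g(2) r x by (simp add: pm_eq_def pm_comp_def)
    then show ?thesis
      using r x by (simp add: \<beta>\<alpha> pm_comp_def pm_hom_mem[OF eI] pm_hom_mem[OF fI]
          pm_hom_mem[OF \<psi>] pm_hom_mem[OF g(1)])
  qed
  ultimately show ?thesis by blast
qed

text \<open>
  The shift by \<open>a\<close> is an automorphism of the category with inverse the shift by \<open>- a\<close>, which is why it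
  preserves epimorphisms and projective modules.
\<close>
lemma pm_hom_unshift:
  assumes "pm_hom n (shift n (- a) M) N f"
  shows "pm_hom n M (shift n a N) (shift_hom n a f)"
  by (rule pm_hom_cong[OF pm_hom_shift[OF assms, of a]]) (auto simp: shift_shift)

lemma pm_projective_shift:
  fixes P :: "('k::field, 'v::ab_group_add) persmod"
  assumes P: "pm_projective n P"
  shows "pm_projective n (shift n a P)"
  unfolding pm_projective_def
proof (intro conjI allI impI)
  have pmP: "persistence_module n P" using P by (simp add: pm_projective_def)
  then show "persistence_module n (shift n a P)" by (rule persistence_module_shift)
  fix E B :: "('k, nat \<Rightarrow> 'k) persmod" and e f
  assume e: "pm_epi n E B e" and f: "pm_hom n (shift n a P) B f"
  have e': "pm_hom n E B e" using e by (simp add: pm_epi_def)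
  have "pm_epi n (shift n (- a) E) (shift n (- a) B) (shift_hom n (- a) e)"
    unfolding pm_epi_def
  proof (intro conjI allI impI)
    show "pm_hom n (shift n (- a) E) (shift n (- a) B) (shift_hom n (- a) e)"
      by (rule pm_hom_shift[OF e'])
    fix C :: "('k, nat \<Rightarrow> 'k) persmod" and g h
    assume g: "pm_hom n (shift n (- a) B) C g" and h: "pm_hom n (shift n (- a) B) C h"
      and eq: "pm_eq n (shift n (- a) E) (pm_comp g (shift_hom n (- a) e))
        (pm_comp h (shift_hom n (- a) e))"
    have "pm_eq n E (pm_comp (shift_hom n a g) e) (pm_comp (shift_hom n a h) e)"
      unfolding pm_eq_def
    proof (intro ballI)
      fix r x assume "r \<in> carrier_vec n" "x \<in> fib E r"
      then show "pm_comp (shift_hom n a g) e r x = pm_comp (shift_hom n a h) e r x"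
        using eq[unfolded pm_eq_def, rule_format, of "translate n a r" x]
        by (simp add: pm_comp_def shift_hom_def)
    qed
    then have *: "pm_eq n B (shift_hom n a g) (shift_hom n a h)"
      using e pm_hom_unshift[OF g] pm_hom_unshift[OF h] unfolding pm_epi_def by blast
    show "pm_eq n (shift n (- a) B) g h"
      unfolding pm_eq_def
    proof (intro ballI)
      fix r x assume "r \<in> carrier_vec n" "x \<in> fib (shift n (- a) B) r"
      then show "g r x = h r x"
        using *[unfolded pm_eq_def, rule_format, of "translate n (- a) r" x]
        by (simp add: shift_hom_def)
    qed
  qed
  moreover have "pm_hom n P (shift n (- a) B) (shift_hom n (- a) f)"
    by (rule pm_hom_unshift) (simp add: f)
  ultimately obtain g where g: "pm_hom n P (shift n (- a) E) g"
    "pm_eq n P (pm_comp (shift_hom n (- a) e) g) (shift_hom n (- a) f)"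
    using P unfolding pm_projective_def by meson
  have "pm_hom n (shift n a P) E (shift_hom n a g)"
    by (rule pm_hom_cong[OF pm_hom_shift[OF g(1), of a]]) (auto simp: shift_shift)
  moreover have "pm_eq n (shift n a P) (pm_comp e (shift_hom n a g)) f"
    unfolding pm_eq_def
  proof (intro ballI)
    fix r x assume "r \<in> carrier_vec n" "x \<in> fib (shift n a P) r"
    then show "pm_comp e (shift_hom n a g) r x = f r x"
      using g(2)[unfolded pm_eq_def, rule_format, of "translate n a r" x]
      by (simp add: pm_comp_def shift_hom_def)
  qed
  ultimately show "\<exists>g. pm_hom n (shift n a P) E g \<and> pm_eq n (shift n a P) (pm_comp e g) f"
    by blast
qed

section \<open>Partial sums\<close>

text \<open>
  The partial sums keep the ambient type and the operations of the full direct sum and differ from it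
  only in their subspaces. So elements of different partial sums can be added and compared, and
  the last partial sum of a finite sequence has the same fibres as \<^const>\<open>direct_sum\<close>.
\<close>
definition partial_sum :: "nat \<Rightarrow> (nat \<Rightarrow> ('k, 'v::zero) persmod) \<Rightarrow> ('k, nat \<Rightarrow> 'v) persmod" where
  "partial_sum m A =
    \<lparr>scl = (\<lambda>c x i. scl (A i) c (x i)),
     fib = (\<lambda>r. {x. (\<forall>i\<le>m. x i \<in> fib (A i) r) \<and> (\<forall>i>m. x i = 0)}),
     tr = (\<lambda>r s x i. tr (A i) r s (x i))\<rparr>"

definition single :: "nat \<Rightarrow> 'v::zero \<Rightarrow> nat \<Rightarrow> 'v" where
  "single i v = (\<lambda>j. if j = i then v else 0)"

definition truncate :: "nat \<Rightarrow> (nat \<Rightarrow> 'v::zero) \<Rightarrow> nat \<Rightarrow> 'v" where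
  "truncate k x = (\<lambda>i. if i \<le> k then x i else 0)"

lemma single_apply [simp]: "single i v i = v" "j \<noteq> i \<Longrightarrow> single i v j = 0"
  by (simp_all add: single_def)

lemma single_zero [simp]: "single i 0 = (0 :: nat \<Rightarrow> 'v::ab_group_add)"
  by (simp add: single_def fun_eq_iff)

lemma single_diff: "single i v - single i w = single i (v - w :: 'v::ab_group_add)"
  by (simp add: single_def fun_eq_iff)

lemma partial_sum_simps [simp]:
  "scl (partial_sum m A) = (\<lambda>c x i. scl (A i) c (x i))"
  "tr (partial_sum m A) r s = (\<lambda>x i. tr (A i) r s (x i))"
  "x \<in> fib (partial_sum m A) r \<longleftrightarrow> (\<forall>i\<le>m. x i \<in> fib (A i) r) \<and> (\<forall>i>m. x i = 0)"
  by (simp_all add: partial_sum_def)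

lemma truncate_partial_sum:
  "x \<in> fib (partial_sum k A) r \<Longrightarrow> k \<le> m \<Longrightarrow> truncate m x = x"
  by (auto simp: truncate_def fun_eq_iff)

lemma sum_single: "(\<Sum>i\<le>m. single i (x i)) = truncate m (x :: nat \<Rightarrow> 'v::ab_group_add)"
proof (induction m)
  case 0
  show ?case by (auto simp: single_def truncate_def)
next
  case (Suc m)
  show ?case unfolding sum.atMost_Suc Suc by (auto simp: single_def truncate_def fun_eq_iff)
qed

lemma single_linear_between:
  assumes "\<And>i. persistence_module n (A i)" "i \<le> m" "r \<in> carrier_vec n"
  shows "linear_between (scl (A i)) (fib (A i) r) (scl (partial_sum m A)) (fib (partial_sum m A) r)
    (single i)"
  using assms(2,3) fib_zero[OF assms(1,3)] scl_zero[OF assms(1)]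
  by (auto simp: linear_between_def single_def fun_eq_iff)

lemma persistence_module_partial_sum:
  assumes A: "\<And>i. persistence_module n (A i)"
  shows "persistence_module n (partial_sum m A)"
  unfolding persistence_module_def
proof (intro conjI ballI impI)
  show vs: "vector_space (scl (partial_sum m A))"
    using vector_space_pointwise[of "\<lambda>i. scl (A i)", OF pm_vector_space[OF A]] by simp
  then interpret vector_space "scl (partial_sum m A)" .
  fix r :: "real vec" assume r: "r \<in> carrier_vec n"
  let ?F = "fib (partial_sum m A) r"
  have sub: "subspace ?F"
    by (rule subspaceI)
      (use fib_zero[OF A r] fib_add[OF A r] fib_scl[OF A r] scl_zero[OF A] in auto)
  have fd: "fd_subspace (scl (partial_sum m A)) (single i ` fib (A i) r)" if "i \<le> m" for i
    by (rule fd_subspace_image[OF pm_vector_space[OF A] vs pm_fd[OF A r]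
        single_linear_between[OF A that r]])
  then have "\<forall>i\<in>{..m}. \<exists>G. finite G \<and> single i ` fib (A i) r = span G"
    by (auto simp: fd_subspace_def)
  then obtain G where G: "\<forall>i\<in>{..m}. finite (G i) \<and> single i ` fib (A i) r = span (G i)"
    by metis
  have "?F \<subseteq> span (\<Union>i\<le>m. G i)"
  proof
    fix x assume x: "x \<in> ?F"
    have "(\<Sum>i\<le>m. single i (x i)) \<in> span (\<Union>i\<le>m. G i)"
    proof (rule span_sum)
      fix i assume i: "i \<in> {..m}"
      have "single i (x i) \<in> span (G i)" using G i x by auto
      then show "single i (x i) \<in> span (\<Union>i\<le>m. G i)"
        using span_mono[of "G i" "\<Union>i\<le>m. G i"] i by auto
    qed
    moreover have "(\<Sum>i\<le>m. single i (x i)) = x"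
      unfolding sum_single by (rule truncate_partial_sum[OF x order_refl])
    ultimately show "x \<in> span (\<Union>i\<le>m. G i)" by simp
  qed
  moreover have "span (\<Union>i\<le>m. G i) \<subseteq> ?F"
  proof (rule span_minimal[OF _ sub], rule UN_least)
    fix i assume i: "i \<in> {..m}"
    have "G i \<subseteq> single i ` fib (A i) r" using G i span_superset by auto
    also have "\<dots> \<subseteq> ?F" using single_linear_between[OF A _ r, of i m] i
      by (auto simp only: linear_between_def atMost_iff)
    finally show "G i \<subseteq> ?F" .
  qed
  moreover have "finite (\<Union>i\<le>m. G i)" using G by auto
  ultimately show "fd_subspace (scl (partial_sum m A)) ?F"
    using sub unfolding fd_subspace_def by blast
  show "tr (partial_sum m A) r r x = x" if "x \<in> ?F" for x
  proof
    fix i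
    show "tr (partial_sum m A) r r x i = x i"
      using that tr_refl[OF A r] fib_zero[OF A r] by (cases "i \<le> m") auto
  qed
  fix s :: "real vec" assume s: "s \<in> carrier_vec n" and rs: "r \<le> s"
  have mem: "x i \<in> fib (A i) r" if "x \<in> ?F" for x i
    using that fib_zero[OF A r] by (cases "i \<le> m") auto
  show "linear_between (scl (partial_sum m A)) ?F (scl (partial_sum m A)) (fib (partial_sum m A) s)
    (tr (partial_sum m A) r s)"
    unfolding linear_between_def
    using tr_mem[OF A r s rs] tr_add[OF A r s rs mem mem] tr_scl[OF A r s rs mem]
      tr_zero[OF A r s rs] by (simp add: fun_eq_iff)
  fix t :: "real vec" and x assume t: "t \<in> carrier_vec n" "s \<le> t" and x: "x \<in> ?F"
  show "tr (partial_sum m A) s t (tr (partial_sum m A) r s x) = tr (partial_sum m A) r t x"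
    using tr_tr[OF A r s t(1) rs t(2) mem[OF x]] by simp
qed

context
  fixes n and A :: "nat \<Rightarrow> ('k::field, 'v::ab_group_add) persmod"
  assumes A: "\<And>i. persistence_module n (A i)"
begin

lemma pm_hom_component:
  assumes "i \<le> m"
  shows "pm_hom n (partial_sum m A) (A i) (\<lambda>r x. x i)"
  by (rule pm_homI) (use assms in \<open>simp_all add: A persistence_module_partial_sum\<close>)

lemma pm_hom_single:
  assumes "i \<le> m"
  shows "pm_hom n (A i) (partial_sum m A) (\<lambda>r. single i)"
  unfolding pm_hom_def
  using single_linear_between[of n A, OF A assms]
  by (simp add: A persistence_module_partial_sum) (simp add: single_def fun_eq_iff tr_zero[OF A])

text \<open>
  The projection to a shorter partial sum and the inclusion into a longer one are the same formula.
\<close>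
lemma pm_hom_truncate:
  "pm_hom n (partial_sum k A) (partial_sum m A) (\<lambda>r. truncate m)"
proof (rule pm_homI)
  fix r :: "real vec" and x assume r: "r \<in> carrier_vec n" and x: "x \<in> fib (partial_sum k A) r"
  have "x i \<in> fib (A i) r" for i
    using x fib_zero[OF A r] by (cases "i \<le> k") auto
  then show "truncate m x \<in> fib (partial_sum m A) r" by (simp add: truncate_def)
qed (simp_all add: truncate_def A persistence_module_partial_sum fun_eq_iff scl_zero[OF A] tr_zero[OF A])

end

lemma pm_hom_sum:
  fixes g :: "nat \<Rightarrow> real vec \<Rightarrow> 'v::ab_group_add \<Rightarrow> 'w::ab_group_add"
  assumes "\<And>i. i \<le> m \<Longrightarrow> pm_hom n M N (g i)"
  shows "pm_hom n M N (\<lambda>r x. \<Sum>i\<le>m. g i r x)"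
  using assms by (induction m) (auto intro!: pm_hom_plus)

lemma pm_hom_apply_sum:
  fixes x :: "nat \<Rightarrow> 'v::ab_group_add"
  assumes f: "pm_hom n M N f" and r: "r \<in> carrier_vec n" and "\<And>i. i \<le> m \<Longrightarrow> x i \<in> fib M r"
  shows "f r (\<Sum>i\<le>m. x i) = (\<Sum>i\<le>m. f r (x i)) \<and> (\<Sum>i\<le>m. x i) \<in> fib M r"
  using assms(3)
  by (induction m) (auto simp: pm_hom_add[OF f r] fib_add[OF pm_hom_dom[OF f] r])

text \<open>
  The lift on the sum is the sum of lifts of the restrictions to the summands.
\<close>
lemma pm_projective_partial_sum:
  fixes A :: "nat \<Rightarrow> ('k::field, 'v::ab_group_add) persmod"
  assumes A: "\<And>i. pm_projective n (A i)"
  shows "pm_projective n (partial_sum m A)"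
  unfolding pm_projective_def
proof (intro conjI allI impI)
  have pm: "\<And>i. persistence_module n (A i)" using A by (simp add: pm_projective_def)
  then show "persistence_module n (partial_sum m A)" by (rule persistence_module_partial_sum)
  fix E B :: "('k, nat \<Rightarrow> 'k) persmod" and e f
  assume e: "pm_epi n E B e" and f: "pm_hom n (partial_sum m A) B f"
  have e': "pm_hom n E B e" using e by (simp add: pm_epi_def)
  have "\<exists>g. pm_hom n (A i) E g \<and> pm_eq n (A i) (pm_comp e g) (pm_comp f (\<lambda>r. single i))"
    if "i \<le> m" for i
    using A[of i] e pm_hom_comp[OF pm_hom_single[of n A, OF pm that] f]
    unfolding pm_projective_def by blast
  then obtain g where g: "\<And>i. i \<le> m \<Longrightarrow> pm_hom n (A i) E (g i)"
    and eg: "\<And>i. i \<le> m \<Longrightarrow> pm_eq n (A i) (pm_comp e (g i)) (pm_comp f (\<lambda>r. single i))"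
    by metis
  let ?g = "\<lambda>r x. \<Sum>i\<le>m. pm_comp (g i) (\<lambda>r x. x i) r x"
  have "pm_hom n (partial_sum m A) E ?g"
    by (intro pm_hom_sum pm_hom_comp[OF pm_hom_component[of n A, OF pm] g])
  moreover have "e r (?g r x) = f r x"
    if r: "r \<in> carrier_vec n" and x: "x \<in> fib (partial_sum m A) r" for r x
  proof -
    have "e r (?g r x) = (\<Sum>i\<le>m. e r (g i r (x i)))"
      using x by (simp add: pm_comp_def pm_hom_apply_sum[OF e' r] pm_hom_mem[OF g r])
    also have "\<dots> = (\<Sum>i\<le>m. f r (single i (x i)))"
      using x r eg by (intro sum.cong refl) (simp add: pm_eq_def pm_comp_def)
    also have "\<dots> = f r (\<Sum>i\<le>m. single i (x i))"
      using x pm_hom_mem[OF pm_hom_single[of n A, OF pm] r]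
      by (intro pm_hom_apply_sum[OF f r, THEN conjunct1, symmetric]) auto
    also have "(\<Sum>i\<le>m. single i (x i)) = x"
      unfolding sum_single by (rule truncate_partial_sum[OF x order_refl])
    finally show ?thesis .
  qed
  ultimately show "\<exists>g. pm_hom n (partial_sum m A) E g \<and> pm_eq n (partial_sum m A) (pm_comp e g) f"
    unfolding pm_eq_def pm_comp_def by blast
qed

section \<open>Crossed resolutions\<close>

text \<open>
  In \<open>image_dA\<close> and \<open>image_dB\<close> the boundaries at \<open>r\<close> are the cycles at \<open>r + \<epsilon>\<close>, because the differentials
  take values in a shift. The augmentations are left out: they enter only the base case of the
  induction, where \<open>ZA 0\<close> and \<open>ZB 0\<close> are their kernels. The axioms are symmetric in \<open>A\<close> and \<open>B\<close>,
  so each statement about a map from the \<open>A\<close>-side to the \<open>B\<close>-side also holds in the other direction.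
\<close>
locale crossed_resolutions =
  fixes n :: nat and \<epsilon> :: real
    and A B :: "nat \<Rightarrow> ('k::field, 'v::ab_group_add) persmod"
    and dA dB :: "nat \<Rightarrow> real vec \<Rightarrow> 'v \<Rightarrow> 'v"
    and ZA ZB :: "nat \<Rightarrow> real vec \<Rightarrow> 'v set"
  assumes eps: "0 \<le> \<epsilon>"
    and projective_A: "pm_projective n (A i)"
    and projective_B: "pm_projective n (B i)"
    and dA: "pm_hom n (A (Suc i)) (shift n \<epsilon> (B i)) (dA i)"
    and dB: "pm_hom n (B (Suc i)) (shift n \<epsilon> (A i)) (dB i)"
    and image_dA: "r \<in> carrier_vec n \<Longrightarrow> dA i r ` fib (A (Suc i)) r = ZB i (translate n \<epsilon> r)"
    and image_dB: "r \<in> carrier_vec n \<Longrightarrow> dB i r ` fib (B (Suc i)) r = ZA i (translate n \<epsilon> r)"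
    and ZA_Suc: "r \<in> carrier_vec n \<Longrightarrow> ZA (Suc i) r = {x \<in> fib (A (Suc i)) r. dA i r x = 0}"
    and ZB_Suc: "r \<in> carrier_vec n \<Longrightarrow> ZB (Suc i) r = {x \<in> fib (B (Suc i)) r. dB i r x = 0}"

lemma crossed_resolutions_swap:
  "crossed_resolutions n \<epsilon> A B dA dB ZA ZB \<Longrightarrow> crossed_resolutions n \<epsilon> B A dB dA ZB ZA"
  unfolding crossed_resolutions_def by simp

text \<open>
  One half of an interleaving, modulo cycles in degree \<open>k\<close>, of the partial sums up to \<open>k\<close>. Both
  halves together are lifts of an interleaving of the quotients by these cycles; working with
  lifts avoids quotient modules.
\<close>
definition round_trip_modulo ::
  "nat \<Rightarrow> real \<Rightarrow> (nat \<Rightarrow> ('k::field, 'v::ab_group_add) persmod) \<Rightarrow> (nat \<Rightarrow> ('k, 'v) persmod) \<Rightarrow>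
    (nat \<Rightarrow> real vec \<Rightarrow> 'v set) \<Rightarrow> (nat \<Rightarrow> real vec \<Rightarrow> 'v set) \<Rightarrow> nat \<Rightarrow>
    (real vec \<Rightarrow> (nat \<Rightarrow> 'v) \<Rightarrow> nat \<Rightarrow> 'v) \<Rightarrow> (real vec \<Rightarrow> (nat \<Rightarrow> 'v) \<Rightarrow> nat \<Rightarrow> 'v) \<Rightarrow> bool" where
  "round_trip_modulo n \<epsilon> A B ZA ZB k F G \<longleftrightarrow>
    pm_hom n (partial_sum k A) (shift n \<epsilon> (partial_sum k B)) F \<and>
    (\<forall>r\<in>carrier_vec n. \<forall>v\<in>ZA k r. F r (single k v) \<in> single k ` ZB k (translate n \<epsilon> r)) \<and>
    (\<forall>r\<in>carrier_vec n. \<forall>x\<in>fib (partial_sum k A) r.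
      tr (partial_sum k A) r (translate n (2 * \<epsilon>) r) x - G (translate n \<epsilon> r) (F r x)
        \<in> single k ` ZA k (translate n (2 * \<epsilon>) r))"

text \<open>
  The next map sends \<open>(x, a)\<close> to \<open>(F x + d a, \<eta> (x, a))\<close>; its entries up to degree \<open>k\<close> are split off
  because \<open>\<eta>\<close> is only chosen once they are known. The truncation in \<open>next_map\<close> is the inclusion of a
  partial sum into the next one.
\<close>
definition next_lower_part ::
  "nat \<Rightarrow> (nat \<Rightarrow> real vec \<Rightarrow> 'v::ab_group_add \<Rightarrow> 'v) \<Rightarrow> (real vec \<Rightarrow> (nat \<Rightarrow> 'v) \<Rightarrow> nat \<Rightarrow> 'v) \<Rightarrow>
    real vec \<Rightarrow> (nat \<Rightarrow> 'v) \<Rightarrow> nat \<Rightarrow> 'v" where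
  "next_lower_part k d F r x = F r (truncate k x) + single k (d k r (x (Suc k)))"

definition next_map ::
  "nat \<Rightarrow> (nat \<Rightarrow> real vec \<Rightarrow> 'v::ab_group_add \<Rightarrow> 'v) \<Rightarrow> (real vec \<Rightarrow> (nat \<Rightarrow> 'v) \<Rightarrow> nat \<Rightarrow> 'v) \<Rightarrow>
    (real vec \<Rightarrow> (nat \<Rightarrow> 'v) \<Rightarrow> 'v) \<Rightarrow> real vec \<Rightarrow> (nat \<Rightarrow> 'v) \<Rightarrow> nat \<Rightarrow> 'v" where
  "next_map k d F \<eta> r x = truncate (Suc k) (next_lower_part k d F r x) + single (Suc k) (\<eta> r x)"

context crossed_resolutions
begin

lemma pm_A: "persistence_module n (A i)" and pm_B: "persistence_module n (B i)"
  using projective_A projective_B by (simp_all add: pm_projective_def)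

lemmas truncate_hom = pm_hom_truncate[of n A, OF pm_A]
lemmas sum_A = persistence_module_partial_sum[of n A, OF pm_A]
lemmas sum_B = persistence_module_partial_sum[of n B, OF pm_B]

lemma next_lower_part_hom:
  assumes F: "pm_hom n (partial_sum k A) (shift n \<epsilon> (partial_sum k B)) F"
  shows "pm_hom n (partial_sum (Suc k) A) (shift n \<epsilon> (partial_sum k B)) (next_lower_part k dA F)"
proof -
  have "pm_hom n (partial_sum (Suc k) A) (shift n \<epsilon> (partial_sum k B))
    (pm_comp (shift_hom n \<epsilon> (\<lambda>r. single k)) (pm_comp (dA k) (\<lambda>r x. x (Suc k))))"
    by (intro pm_hom_comp[OF _ pm_hom_shift[OF pm_hom_single[of n B, OF pm_B order_refl]]]
        pm_hom_comp[OF _ dA] pm_hom_component[of n A, OF pm_A]) simp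
  from pm_hom_plus[OF pm_hom_comp[OF truncate_hom F] this]
  show ?thesis by (simp add: pm_comp_def shift_hom_def next_lower_part_def[abs_def])
qed

text \<open>
  The difference of the structure map and the way back through \<open>G\<close> is a cycle in degree \<open>k\<close>, hence
  pointwise a boundary; projectivity of the partial sum makes the choice of a preimage natural.
\<close>
lemma lift_next_component:
  assumes FG: "round_trip_modulo n \<epsilon> A B ZA ZB k F G"
    and GF: "round_trip_modulo n \<epsilon> B A ZB ZA k G F"
  shows "\<exists>\<eta>. pm_hom n (partial_sum (Suc k) A) (shift n \<epsilon> (B (Suc k))) \<eta> \<and>
    (\<forall>r\<in>carrier_vec n. \<forall>x\<in>fib (partial_sum (Suc k) A) r.
      single k (dB k (translate n \<epsilon> r) (\<eta> r x)) =
      tr (partial_sum k A) r (translate n (2 * \<epsilon>) r) (truncate k x)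
        - G (translate n \<epsilon> r) (next_lower_part k dA F r x))"
proof -
  let ?X = "partial_sum (Suc k) A"
  have F: "pm_hom n (partial_sum k A) (shift n \<epsilon> (partial_sum k B)) F"
    and G: "pm_hom n (partial_sum k B) (shift n \<epsilon> (partial_sum k A)) G"
    using FG GF by (simp_all add: round_trip_modulo_def)
  \<comment> \<open>\<open>\<eta>\<close> has to be a lift of this map, which takes values in degree \<open>k\<close> only, along the differential.\<close>
  define defect where "defect = (\<lambda>r x.
    pm_comp (shift_unit n (2 * \<epsilon>) (partial_sum k A)) (\<lambda>r. truncate k) r x
    - pm_comp (shift_hom n \<epsilon> G) (next_lower_part k dA F) r x)"
  have "pm_hom n ?X (shift n (2 * \<epsilon>) (partial_sum k A))
    (pm_comp (shift_unit n (2 * \<epsilon>) (partial_sum k A)) (\<lambda>r. truncate k))"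
    using eps by (intro pm_hom_comp[OF truncate_hom] pm_hom_tr sum_A) simp
  moreover have "pm_hom n ?X (shift n (2 * \<epsilon>) (partial_sum k A))
    (pm_comp (shift_hom n \<epsilon> G) (next_lower_part k dA F))"
    using pm_hom_comp[OF next_lower_part_hom[OF F] pm_hom_shift[OF G, of \<epsilon>]]
    by (simp only: shift_shift mult_2)
  ultimately have "pm_hom n ?X (shift n (2 * \<epsilon>) (partial_sum k A)) defect"
    unfolding defect_def by (rule pm_hom_minus)
  from pm_hom_comp[OF this pm_hom_shift[OF pm_hom_component[of n A, OF pm_A order_refl]]]
  have h: "pm_hom n ?X (shift n (2 * \<epsilon>) (A k)) (\<lambda>r x. defect r x k)"
    by (simp add: pm_comp_def shift_hom_def)
  \<comment> \<open>Shifted once, the differential ends where the defect does, in \<open>A k\<close> shifted by \<open>2 * \<epsilon>\<close>.\<close>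
  have d: "pm_hom n (shift n \<epsilon> (B (Suc k))) (shift n (2 * \<epsilon>) (A k)) (shift_hom n \<epsilon> (dB k))"
    using pm_hom_shift[OF dB, of \<epsilon> k] by (simp only: shift_shift mult_2)
  have defect: "defect r x \<in> single k ` dB k (translate n \<epsilon> r) ` fib (B (Suc k)) (translate n \<epsilon> r)"
    if r: "r \<in> carrier_vec n" and x: "x \<in> fib ?X r" for r x
  proof -
    let ?r1 = "translate n \<epsilon> r" and ?r2 = "translate n (2 * \<epsilon>) r"
    have r1: "?r1 \<in> carrier_vec n" and r2: "translate n \<epsilon> ?r1 = ?r2"
      using r by (simp_all flip: mult_2)
    let ?a = "x (Suc k)"
    have \<tau>: "truncate k x \<in> fib (partial_sum k A) r" by (rule pm_hom_mem[OF truncate_hom r x])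
    have F\<tau>: "F r (truncate k x) \<in> fib (partial_sum k B) ?r1" using pm_hom_mem[OF F r \<tau>] by simp
    have a: "?a \<in> fib (A (Suc k)) r" using x by simp
    have da: "dA k r ?a \<in> ZB k ?r1" using image_dA[OF r, of k] a by blast
    have sda: "single k (dA k r ?a) \<in> fib (partial_sum k B) ?r1"
      using pm_hom_mem[OF pm_hom_single[of n B, OF pm_B order_refl] r1] pm_hom_mem[OF dA r a] by simp
    obtain v where v: "v \<in> ZA k ?r2"
      "tr (partial_sum k A) r ?r2 (truncate k x) - G ?r1 (F r (truncate k x)) = single k v"
      using FG r \<tau> unfolding round_trip_modulo_def by blast
    obtain w where w: "w \<in> ZA k ?r2" "G ?r1 (single k (dA k r ?a)) = single k w"
      using GF r1 r2 da unfolding round_trip_modulo_def by (metis imageE)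
    have "defect r x = single k v - single k w"
      unfolding v(2)[symmetric] w(2)[symmetric]
      by (simp only: defect_def pm_comp_def shift_unit_def shift_hom_def next_lower_part_def
          pm_hom_add[OF G r1 F\<tau> sda] diff_diff_add)
    moreover have "v - w \<in> dB k ?r1 ` fib (B (Suc k)) ?r1"
    proof -
      obtain v' w' where "v' \<in> fib (B (Suc k)) ?r1" "w' \<in> fib (B (Suc k)) ?r1"
        "v = dB k ?r1 v'" "w = dB k ?r1 w'"
        using v(1) w(1) image_dB[OF r1, of k, unfolded r2] by blast
      then show ?thesis
        using pm_hom_diff[OF dB r1] fib_diff[OF pm_B r1] by (metis imageI)
    qed
    ultimately show ?thesis by (simp add: single_diff)
  qed
  have "defect r x k \<in> shift_hom n \<epsilon> (dB k) r ` fib (shift n \<epsilon> (B (Suc k))) r"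
    if r: "r \<in> carrier_vec n" and x: "x \<in> fib ?X r" for r x
  proof -
    obtain u where "defect r x = single k u"
      "u \<in> dB k (translate n \<epsilon> r) ` fib (B (Suc k)) (translate n \<epsilon> r)"
      using defect[OF r x] by (rule imageE)
    then show ?thesis by (simp add: shift_hom_def)
  qed
  from projective_lift_through_image[OF pm_projective_partial_sum[of n A, OF projective_A] h d this]
  obtain \<eta> where \<eta>: "pm_hom n ?X (shift n \<epsilon> (B (Suc k))) \<eta>"
    and d\<eta>: "\<forall>r\<in>carrier_vec n. \<forall>x\<in>fib ?X r. shift_hom n \<epsilon> (dB k) r (\<eta> r x) = defect r x k"
    by blast
  have "single k (dB k (translate n \<epsilon> r) (\<eta> r x)) =
      tr (partial_sum k A) r (translate n (2 * \<epsilon>) r) (truncate k x)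
        - G (translate n \<epsilon> r) (next_lower_part k dA F r x)"
    if r: "r \<in> carrier_vec n" and x: "x \<in> fib ?X r" for r x
  proof -
    obtain u where u: "defect r x = single k u" using defect[OF r x] by (rule imageE)
    then have "dB k (translate n \<epsilon> r) (\<eta> r x) = u"
      using d\<eta> r x by (simp add: shift_hom_def)
    then have "single k (dB k (translate n \<epsilon> r) (\<eta> r x)) = defect r x" using u by simp
    then show ?thesis
      by (simp only: defect_def pm_comp_def shift_unit_def shift_hom_def)
  qed
  then show ?thesis using \<eta> by (intro exI[of _ \<eta>] conjI ballI)
qed

lemma tr_partial_sum_Suc:
  assumes "r \<in> carrier_vec n" "s \<in> carrier_vec n" "r \<le> s" "x \<in> fib (partial_sum (Suc k) A) r"
  shows "tr (partial_sum (Suc k) A) r s x =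
    tr (partial_sum k A) r s (truncate k x) + single (Suc k) (tr (A (Suc k)) r s (x (Suc k)))"
proof
  fix i
  have z: "tr (A i) r s 0 = 0" by (rule tr_zero[OF pm_A assms(1-3)])
  consider "i \<le> k" | "i = Suc k" | "i > Suc k" by linarith
  then show "tr (partial_sum (Suc k) A) r s x i =
    (tr (partial_sum k A) r s (truncate k x) + single (Suc k) (tr (A (Suc k)) r s (x (Suc k)))) i"
    using assms(4) z by cases (auto simp: truncate_def)
qed

text \<open>
  By the choice of \<open>\<eta>\<close>, the composite agrees with the structure map in the degrees up to \<open>k\<close>. In
  degree \<open>k + 1\<close> the deviation is a cycle: applying the differential to \<open>\<theta>\<close> gives, by the
  choice of \<open>\<theta>\<close> and naturality of \<open>F\<close>, the structure map applied to \<open>d a\<close>.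
\<close>
lemma round_trip_next:
  assumes FG: "round_trip_modulo n \<epsilon> A B ZA ZB k F G"
    and GF: "round_trip_modulo n \<epsilon> B A ZB ZA k G F"
    and \<eta>: "pm_hom n (partial_sum (Suc k) A) (shift n \<epsilon> (B (Suc k))) \<eta>"
    and d\<eta>: "\<forall>r\<in>carrier_vec n. \<forall>x\<in>fib (partial_sum (Suc k) A) r.
      single k (dB k (translate n \<epsilon> r) (\<eta> r x)) =
      tr (partial_sum k A) r (translate n (2 * \<epsilon>) r) (truncate k x)
        - G (translate n \<epsilon> r) (next_lower_part k dA F r x)"
    and \<theta>: "pm_hom n (partial_sum (Suc k) B) (shift n \<epsilon> (A (Suc k))) \<theta>"
    and d\<theta>: "\<forall>r\<in>carrier_vec n. \<forall>y\<in>fib (partial_sum (Suc k) B) r.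
      single k (dA k (translate n \<epsilon> r) (\<theta> r y)) =
      tr (partial_sum k B) r (translate n (2 * \<epsilon>) r) (truncate k y)
        - F (translate n \<epsilon> r) (next_lower_part k dB G r y)"
  shows "round_trip_modulo n \<epsilon> A B ZA ZB (Suc k) (next_map k dA F \<eta>) (next_map k dB G \<theta>)"
  unfolding round_trip_modulo_def
proof (intro conjI ballI)
  interpret swapped: crossed_resolutions n \<epsilon> B A dB dA ZB ZA
    by (rule crossed_resolutions_swap) (rule crossed_resolutions_axioms)
  have F: "pm_hom n (partial_sum k A) (shift n \<epsilon> (partial_sum k B)) F"
    and G: "pm_hom n (partial_sum k B) (shift n \<epsilon> (partial_sum k A)) G"
    using FG GF by (simp_all add: round_trip_modulo_def)
  note low_hom = next_lower_part_hom[OF F]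
  have "pm_hom n (partial_sum (Suc k) A) (shift n \<epsilon> (partial_sum (Suc k) B))
    (pm_comp (shift_hom n \<epsilon> (\<lambda>r. truncate (Suc k))) (next_lower_part k dA F))"
    by (rule pm_hom_comp[OF low_hom pm_hom_shift[OF swapped.truncate_hom]])
  moreover have "pm_hom n (partial_sum (Suc k) A) (shift n \<epsilon> (partial_sum (Suc k) B))
    (pm_comp (shift_hom n \<epsilon> (\<lambda>r. single (Suc k))) \<eta>)"
    by (rule pm_hom_comp[OF \<eta> pm_hom_shift[OF pm_hom_single[of n B, OF pm_B order_refl]]])
  ultimately have "pm_hom n (partial_sum (Suc k) A) (shift n \<epsilon> (partial_sum (Suc k) B))
    (\<lambda>r x. pm_comp (shift_hom n \<epsilon> (\<lambda>r. truncate (Suc k))) (next_lower_part k dA F) r x +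
      pm_comp (shift_hom n \<epsilon> (\<lambda>r. single (Suc k))) \<eta> r x)"
    by (rule pm_hom_plus)
  then show F': "pm_hom n (partial_sum (Suc k) A) (shift n \<epsilon> (partial_sum (Suc k) B))
    (next_map k dA F \<eta>)"
    by (simp add: pm_comp_def shift_hom_def next_map_def[abs_def])
  fix r :: "real vec" assume r: "r \<in> carrier_vec n"
  define r1 r2 r3 where "r1 = translate n \<epsilon> r" and "r2 = translate n \<epsilon> r1" and "r3 = translate n \<epsilon> r2"
  have tr_eqs: "translate n \<epsilon> r = r1" "translate n (2 * \<epsilon>) r = r2" "translate n \<epsilon> r1 = r2"
    "translate n (2 * \<epsilon>) r1 = r3" "translate n \<epsilon> r2 = r3"
    by (simp_all add: r1_def r2_def r3_def)
  have c: "r1 \<in> carrier_vec n" "r2 \<in> carrier_vec n" "r3 \<in> carrier_vec n"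
    using r by (simp_all add: r1_def r2_def r3_def)
  have le: "r \<le> r2" "r1 \<le> r3"
    using le_translate[of _ n "2 * \<epsilon>"] eps r c tr_eqs by (metis mult_nonneg_nonneg zero_le_numeral)+
  note F_mem = pm_hom_mem[OF F r, unfolded shift_simps tr_eqs]
  note d\<eta>' = d\<eta>[rule_format, OF r, unfolded tr_eqs]
  note d\<theta>' = d\<theta>[rule_format, OF c(1), unfolded tr_eqs]
  have low_mem: "next_lower_part k dA F r x \<in> fib (partial_sum k B) r1"
    if "x \<in> fib (partial_sum (Suc k) A) r" for x
    using pm_hom_mem[OF low_hom r that] by (simp only: shift_simps tr_eqs)
  have next_eq: "next_map k dA F \<eta> r x = next_lower_part k dA F r x + single (Suc k) (\<eta> r x)"
    if "x \<in> fib (partial_sum (Suc k) A) r" for x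
    unfolding next_map_def using truncate_partial_sum[OF low_mem[OF that]] by simp
  {
    fix v assume v: "v \<in> ZA (Suc k) r"
    then have v': "v \<in> fib (A (Suc k)) r" "dA k r v = 0" using ZA_Suc[OF r] by auto
    let ?x = "single (Suc k) v"
    have x: "?x \<in> fib (partial_sum (Suc k) A) r"
      using pm_hom_mem[OF pm_hom_single[of n A, OF pm_A order_refl] r v'(1)] .
    have \<tau>0: "truncate k ?x = 0" by (simp add: truncate_def fun_eq_iff single_def)
    have low0: "next_lower_part k dA F r ?x = 0"
      by (simp add: next_lower_part_def \<tau>0 v'(2) pm_hom_zero[OF F r])
    have "single k (dB k r1 (\<eta> r ?x)) = (0 :: nat \<Rightarrow> 'v)"
      unfolding d\<eta>'[OF x] low0 \<tau>0 pm_hom_zero[OF G c(1)]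
      by (simp only: tr_zero[OF sum_A r c(2) le(1)] diff_self)
    then have "dB k r1 (\<eta> r ?x) = 0" by (metis single_apply(1) zero_fun_apply)
    moreover have "\<eta> r ?x \<in> fib (B (Suc k)) r1"
      using pm_hom_mem[OF \<eta> r x] by (simp only: shift_simps tr_eqs)
    ultimately have "\<eta> r ?x \<in> ZB (Suc k) r1" using ZB_Suc[OF c(1)] by simp
    moreover have "next_map k dA F \<eta> r ?x = single (Suc k) (\<eta> r ?x)"
      unfolding next_eq[OF x] low0 by simp
    ultimately show "next_map k dA F \<eta> r ?x \<in> single (Suc k) ` ZB (Suc k) (translate n \<epsilon> r)"
      unfolding tr_eqs by simp
  }
  fix x assume x: "x \<in> fib (partial_sum (Suc k) A) r"
  define low where "low = next_lower_part k dA F r x"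
  define y where "y = next_map k dA F \<eta> r x"
  define a where "a = x (Suc k)"
  define t where "t = tr (partial_sum k A) r r2 (truncate k x)"
  have \<tau>: "truncate k x \<in> fib (partial_sum k A) r" by (rule pm_hom_mem[OF truncate_hom r x])
  have a: "a \<in> fib (A (Suc k)) r" using x by (simp add: a_def)
  have low: "low \<in> fib (partial_sum k B) r1" unfolding low_def by (rule low_mem[OF x])
  have y: "y \<in> fib (partial_sum (Suc k) B) r1"
    using pm_hom_mem[OF F' r x] unfolding y_def by (simp only: shift_simps tr_eqs)
  have y_eq: "y = low + single (Suc k) (\<eta> r x)" unfolding y_def low_def by (rule next_eq[OF x])
  have \<tau>y: "truncate k y = low"
    using low unfolding y_eq by (auto simp: truncate_def fun_eq_iff single_def)
  have y_last: "y (Suc k) = \<eta> r x" using low unfolding y_eq by simp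
  have t: "t \<in> fib (partial_sum k A) r2"
    unfolding t_def by (rule tr_mem[OF sum_A r c(2) le(1) \<tau>])
  \<comment> \<open>\<open>\<eta>\<close> is chosen for this equation: its differential supplies what \<open>G\<close> misses.\<close>
  have low_back: "next_lower_part k dB G r1 y = t"
    unfolding next_lower_part_def[of k dB] \<tau>y y_last d\<eta>'[OF x] t_def low_def by simp
  have round_trip: "next_map k dB G \<theta> r1 y = t + single (Suc k) (\<theta> r1 y)"
    unfolding next_map_def low_back truncate_partial_sum[OF t le_SucI[OF order_refl]] ..
  have diff: "tr (partial_sum (Suc k) A) r r2 x - next_map k dB G \<theta> r1 y =
      single (Suc k) (tr (A (Suc k)) r r2 a - \<theta> r1 y)"
    unfolding tr_partial_sum_Suc[OF r c(2) le(1) x] round_trip single_diff[symmetric]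
    by (simp only: t_def a_def add_diff_add diff_self add_0)
  have da: "dA k r a \<in> fib (B k) r1"
    using pm_hom_mem[OF dA r a] by (simp only: shift_simps tr_eqs)
  have sda: "single k (dA k r a) \<in> fib (partial_sum k B) r1"
    using pm_hom_mem[OF pm_hom_single[of n B, OF pm_B order_refl] c(1) da] .
  have "single k (dA k r2 (\<theta> r1 y)) = tr (partial_sum k B) r1 r3 low - F r2 t"
    unfolding d\<theta>'[OF y] \<tau>y low_back ..
  also have "F r2 t = tr (partial_sum k B) r1 r3 (F r (truncate k x))"
    unfolding t_def pm_hom_natural[OF F r c(2) le(1) \<tau>] shift_simps tr_eqs ..
  also have "tr (partial_sum k B) r1 r3 low = tr (partial_sum k B) r1 r3 (F r (truncate k x))
      + tr (partial_sum k B) r1 r3 (single k (dA k r a))"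
    unfolding low_def next_lower_part_def a_def[symmetric]
    by (rule tr_add[OF sum_B c(1,3) le(2) F_mem[OF \<tau>] sda])
  also have "tr (partial_sum k B) r1 r3 (single k (dA k r a)) = single k (tr (B k) r1 r3 (dA k r a))"
    using pm_hom_natural[OF pm_hom_single[of n B k k, OF pm_B order_refl] c(1,3) le(2) da] by simp
  also have "tr (B k) r1 r3 (dA k r a) = dA k r2 (tr (A (Suc k)) r r2 a)"
    unfolding pm_hom_natural[OF dA r c(2) le(1) a] shift_simps tr_eqs ..
  finally have "single k (dA k r2 (\<theta> r1 y)) = single k (dA k r2 (tr (A (Suc k)) r r2 a))"
    by (simp only: add_diff_cancel_left')
  then have eq: "dA k r2 (\<theta> r1 y) = dA k r2 (tr (A (Suc k)) r r2 a)" by (metis single_apply(1))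
  have ta: "tr (A (Suc k)) r r2 a \<in> fib (A (Suc k)) r2" by (rule tr_mem[OF pm_A r c(2) le(1) a])
  have \<theta>y: "\<theta> r1 y \<in> fib (A (Suc k)) r2"
    using pm_hom_mem[OF \<theta> c(1) y] by (simp only: shift_simps tr_eqs)
  have "tr (A (Suc k)) r r2 a - \<theta> r1 y \<in> ZA (Suc k) r2"
    unfolding ZA_Suc[OF c(2)]
    using fib_diff[OF pm_A c(2) ta \<theta>y] pm_hom_diff[OF dA c(2) ta \<theta>y] eq by simp
  then show "tr (partial_sum (Suc k) A) r (translate n (2 * \<epsilon>) r) x
      - next_map k dB G \<theta> (translate n \<epsilon> r) (next_map k dA F \<eta> r x)
      \<in> single (Suc k) ` ZA (Suc k) (translate n (2 * \<epsilon>) r)"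
    unfolding tr_eqs y_def[symmetric] diff by (rule imageI)
qed

lemma interleaving_modulo_cycles:
  assumes "\<exists>F G. round_trip_modulo n \<epsilon> A B ZA ZB 0 F G \<and> round_trip_modulo n \<epsilon> B A ZB ZA 0 G F"
  shows "\<exists>F G. round_trip_modulo n \<epsilon> A B ZA ZB k F G \<and> round_trip_modulo n \<epsilon> B A ZB ZA k G F"
proof (induction k)
  case 0
  show ?case by (rule assms)
next
  case (Suc k)
  interpret swapped: crossed_resolutions n \<epsilon> B A dB dA ZB ZA
    by (rule crossed_resolutions_swap) (rule crossed_resolutions_axioms)
  from Suc obtain F G where FG: "round_trip_modulo n \<epsilon> A B ZA ZB k F G"
    and GF: "round_trip_modulo n \<epsilon> B A ZB ZA k G F" by blast
  obtain \<eta> where \<eta>: "pm_hom n (partial_sum (Suc k) A) (shift n \<epsilon> (B (Suc k))) \<eta>"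
    "\<forall>r\<in>carrier_vec n. \<forall>x\<in>fib (partial_sum (Suc k) A) r.
      single k (dB k (translate n \<epsilon> r) (\<eta> r x)) =
      tr (partial_sum k A) r (translate n (2 * \<epsilon>) r) (truncate k x)
        - G (translate n \<epsilon> r) (next_lower_part k dA F r x)"
    using lift_next_component[OF FG GF] by (elim exE conjE)
  obtain \<theta> where \<theta>: "pm_hom n (partial_sum (Suc k) B) (shift n \<epsilon> (A (Suc k))) \<theta>"
    "\<forall>r\<in>carrier_vec n. \<forall>y\<in>fib (partial_sum (Suc k) B) r.
      single k (dA k (translate n \<epsilon> r) (\<theta> r y)) =
      tr (partial_sum k B) r (translate n (2 * \<epsilon>) r) (truncate k y)
        - F (translate n \<epsilon> r) (next_lower_part k dB G r y)"
    using swapped.lift_next_component[OF GF FG] by (elim exE conjE)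
  have "round_trip_modulo n \<epsilon> A B ZA ZB (Suc k) (next_map k dA F \<eta>) (next_map k dB G \<theta>)"
    by (rule round_trip_next[OF FG GF \<eta> \<theta>])
  moreover have "round_trip_modulo n \<epsilon> B A ZB ZA (Suc k) (next_map k dB G \<theta>) (next_map k dA F \<eta>)"
    by (rule swapped.round_trip_next[OF GF FG \<theta> \<eta>])
  ultimately show ?case by blast
qed

end

section \<open>From interleaved modules to interleaved direct sums\<close>

lemma fib_direct_sum_eq_partial_sum:
  assumes "\<And>i. 0 \<in> fib (A i) r" "\<And>i. m \<le> i \<Longrightarrow> fib (A i) r = {0}"
  shows "fib (direct_sum A) r = fib (partial_sum m A) r"
proof (intro equalityI subsetI)
  fix x assume "x \<in> fib (direct_sum A) r"
  then have x: "x i \<in> fib (A i) r" for i by simp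
  then have "x i = 0" if "m < i" for i using assms(2)[of i] x[of i] that by simp
  then show "x \<in> fib (partial_sum m A) r" using x by simp
next
  fix x assume x: "x \<in> fib (partial_sum m A) r"
  then have "{i. x i \<noteq> 0} \<subseteq> {..m}"
    by (metis (mono_tags, lifting) atMost_iff linorder_not_less mem_Collect_eq
        partial_sum_simps(3) subsetI)
  then have "finite {i. x i \<noteq> 0}" by (rule finite_subset) simp
  moreover have "x i \<in> fib (A i) r" for i using x assms(1) by (cases "i \<le> m") auto
  ultimately show "x \<in> fib (direct_sum A) r" by simp
qed

context crossed_resolutions
begin

lemma lift_to_first_summands:
  assumes aA: "pm_hom n (A 0) M aA" and aB: "pm_hom n (B 0) N aB"
    and onto: "\<And>r. r \<in> carrier_vec n \<Longrightarrow> fib N r \<subseteq> aB r ` fib (B 0) r"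
    and f: "pm_hom n M (shift n \<epsilon> N) f"
  shows "\<exists>F. pm_hom n (partial_sum 0 A) (shift n \<epsilon> (partial_sum 0 B)) F \<and>
    (\<forall>r\<in>carrier_vec n. \<forall>x\<in>fib (partial_sum 0 A) r.
      aB (translate n \<epsilon> r) (F r x 0) = f r (aA r (x 0)))"
proof -
  have "\<exists>F0. pm_hom n (A 0) (shift n \<epsilon> (B 0)) F0 \<and>
    (\<forall>r\<in>carrier_vec n. \<forall>x\<in>fib (A 0) r. shift_hom n \<epsilon> aB r (F0 r x) = pm_comp f aA r x)"
  proof (rule projective_lift_through_image[OF projective_A pm_hom_comp[OF aA f] pm_hom_shift[OF aB]])
    fix r x assume r: "r \<in> carrier_vec n" and x: "x \<in> fib (A 0) r"
    have "pm_comp f aA r x \<in> fib N (translate n \<epsilon> r)"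
      using pm_hom_mem[OF pm_hom_comp[OF aA f] r x] by simp
    then show "pm_comp f aA r x \<in> shift_hom n \<epsilon> aB r ` fib (shift n \<epsilon> (B 0)) r"
      using onto[of "translate n \<epsilon> r"] r by (auto simp: shift_hom_def)
  qed
  then obtain F0 where F0: "pm_hom n (A 0) (shift n \<epsilon> (B 0)) F0"
    "\<forall>r\<in>carrier_vec n. \<forall>x\<in>fib (A 0) r. shift_hom n \<epsilon> aB r (F0 r x) = pm_comp f aA r x"
    by blast
  let ?F = "pm_comp (shift_hom n \<epsilon> (\<lambda>r. single 0)) (pm_comp F0 (\<lambda>r x. x 0))"
  have "pm_hom n (partial_sum 0 A) (shift n \<epsilon> (partial_sum 0 B)) ?F"
    by (intro pm_hom_comp[OF _ pm_hom_shift[OF pm_hom_single[of n B, OF pm_B order_refl]]]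
        pm_hom_comp[OF _ F0(1)] pm_hom_component[of n A, OF pm_A order_refl])
  moreover have "\<forall>r\<in>carrier_vec n. \<forall>x\<in>fib (partial_sum 0 A) r.
      aB (translate n \<epsilon> r) (?F r x 0) = f r (aA r (x 0))"
    using F0(2) by (simp add: pm_comp_def shift_hom_def)
  ultimately show ?thesis by blast
qed

text \<open>
  The augmentation carries the composite of the lifts to the composite of \<open>f\<close> and \<open>g\<close>, which is a
  structure map of \<open>M\<close>; so the deviation lies in the kernel of the augmentation.
\<close>
lemma round_trip_first_summands:
  assumes aA: "pm_hom n (A 0) M aA" and aB: "pm_hom n (B 0) N aB"
    and ZA: "\<And>r. r \<in> carrier_vec n \<Longrightarrow> ZA 0 r = {x \<in> fib (A 0) r. aA r x = 0}"
    and ZB: "\<And>r. r \<in> carrier_vec n \<Longrightarrow> ZB 0 r = {x \<in> fib (B 0) r. aB r x = 0}"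
    and f: "pm_hom n M (shift n \<epsilon> N) f"
    and gf: "pm_eq n M (pm_comp (shift_hom n \<epsilon> g) f) (shift_unit n (2 * \<epsilon>) M)"
    and F: "pm_hom n (partial_sum 0 A) (shift n \<epsilon> (partial_sum 0 B)) F"
    and G: "pm_hom n (partial_sum 0 B) (shift n \<epsilon> (partial_sum 0 A)) G"
    and aF: "\<forall>r\<in>carrier_vec n. \<forall>x\<in>fib (partial_sum 0 A) r.
      aB (translate n \<epsilon> r) (F r x 0) = f r (aA r (x 0))"
    and aG: "\<forall>r\<in>carrier_vec n. \<forall>y\<in>fib (partial_sum 0 B) r.
      aA (translate n \<epsilon> r) (G r y 0) = g r (aB r (y 0))"
  shows "round_trip_modulo n \<epsilon> A B ZA ZB 0 F G"
  unfolding round_trip_modulo_def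
proof (intro conjI ballI F)
  fix r :: "real vec" assume r: "r \<in> carrier_vec n"
  define r1 r2 where "r1 = translate n \<epsilon> r" and "r2 = translate n \<epsilon> r1"
  have tr_eqs: "translate n \<epsilon> r = r1" "translate n (2 * \<epsilon>) r = r2" "translate n \<epsilon> r1 = r2"
    by (simp_all add: r1_def r2_def)
  have c: "r1 \<in> carrier_vec n" "r2 \<in> carrier_vec n" using r by (simp_all add: r1_def r2_def)
  have le: "r \<le> r2"
    using le_translate[of r n "2 * \<epsilon>"] eps r tr_eqs by simp
  {
    fix v assume "v \<in> ZA 0 r"
    then have v: "v \<in> fib (A 0) r" "aA r v = 0" using ZA[OF r] by auto
    have x: "single 0 v \<in> fib (partial_sum 0 A) r" using v by simp
    let ?w = "F r (single 0 v)"
    have w: "?w \<in> fib (partial_sum 0 B) r1"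
      using pm_hom_mem[OF F r x] by (simp only: shift_simps tr_eqs)
    have "?w = single 0 (?w 0)" using w by (auto simp: single_def fun_eq_iff)
    moreover have "?w 0 \<in> ZB 0 r1"
      using w aF[rule_format, OF r x] unfolding ZB[OF c(1)] tr_eqs
      by (simp add: v(2) pm_hom_zero[OF f r])
    ultimately show "?w \<in> single 0 ` ZB 0 (translate n \<epsilon> r)"
      unfolding tr_eqs by (rule image_eqI)
  }
  fix x assume x: "x \<in> fib (partial_sum 0 A) r"
  have Fx: "F r x \<in> fib (partial_sum 0 B) r1"
    using pm_hom_mem[OF F r x] by (simp only: shift_simps tr_eqs)
  have GFx: "G r1 (F r x) \<in> fib (partial_sum 0 A) r2"
    using pm_hom_mem[OF G c(1) Fx] by (simp only: shift_simps tr_eqs)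
  let ?z = "tr (partial_sum 0 A) r r2 x - G r1 (F r x)"
  have z: "?z \<in> fib (partial_sum 0 A) r2"
    by (rule fib_diff[OF sum_A c(2) tr_mem[OF sum_A r c(2) le x] GFx])
  have x0: "x 0 \<in> fib (A 0) r" using x by simp
  have tx0: "tr (A 0) r r2 (x 0) \<in> fib (A 0) r2" by (rule tr_mem[OF pm_A r c(2) le x0])
  have "aA r2 (?z 0) = aA r2 (tr (A 0) r r2 (x 0)) - aA r2 (G r1 (F r x) 0)"
    using pm_hom_diff[OF aA c(2) tx0] GFx by simp
  also have "aA r2 (G r1 (F r x) 0) = g r1 (f r (aA r (x 0)))"
    using aG[rule_format, OF c(1) Fx] aF[rule_format, OF r x] by (simp only: tr_eqs)
  also have "\<dots> = tr M r r2 (aA r (x 0))"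
    using gf[unfolded pm_eq_def, rule_format, OF r pm_hom_mem[OF aA r x0]]
    by (simp only: pm_comp_def shift_hom_def shift_unit_def tr_eqs)
  finally have "aA r2 (?z 0) = 0" using pm_hom_natural[OF aA r c(2) le x0] by simp
  then have "?z 0 \<in> ZA 0 r2" using z unfolding ZA[OF c(2)] by simp
  moreover have "?z = single 0 (?z 0)"
  proof
    fix i
    show "?z i = single 0 (?z 0) i"
    proof (cases "i = 0")
      case False
      then show ?thesis using z unfolding partial_sum_simps(3) single_def by simp
    qed simp
  qed
  ultimately show "tr (partial_sum 0 A) r (translate n (2 * \<epsilon>) r) x - G (translate n \<epsilon> r) (F r x)
      \<in> single 0 ` ZA 0 (translate n (2 * \<epsilon>) r)"
    unfolding tr_eqs by (rule image_eqI[rotated])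
qed

text \<open>
  When the summands vanish from degree \<open>l\<close> on, so do the cycles in degree \<open>l\<close>, and the identity
  modulo these cycles becomes exact.
\<close>
lemma shift_unit_direct_sum:
  assumes round_trip: "round_trip_modulo n \<epsilon> A B ZA ZB l F G"
    and l: "\<forall>i\<ge>l. \<forall>r\<in>carrier_vec n. fib (A i) r = {0}"
  shows "pm_eq n (direct_sum A) (pm_comp (shift_hom n \<epsilon> G) F) (shift_unit n (2 * \<epsilon>) (direct_sum A))"
  unfolding pm_eq_def
proof (intro ballI)
  fix r x assume r: "r \<in> carrier_vec n" and x: "x \<in> fib (direct_sum A) r"
  have r2: "translate n (2 * \<epsilon>) r = translate n \<epsilon> (translate n \<epsilon> r)" by simp
  have "ZA l (translate n (2 * \<epsilon>) r) \<subseteq> fib (A l) (translate n (2 * \<epsilon>) r)"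
  proof -
    have r1: "translate n \<epsilon> r \<in> carrier_vec n" using r by simp
    have "dB l (translate n \<epsilon> r) ` fib (B (Suc l)) (translate n \<epsilon> r)
        \<subseteq> fib (A l) (translate n \<epsilon> (translate n \<epsilon> r))"
      using pm_hom_mem[OF dB r1] by (simp only: image_subset_iff shift_simps) blast
    then show ?thesis by (simp only: image_dB[OF r1] r2)
  qed
  then have "ZA l (translate n (2 * \<epsilon>) r) \<subseteq> {0}" using l r by simp
  moreover have "fib (direct_sum A) r = fib (partial_sum l A) r"
    by (rule fib_direct_sum_eq_partial_sum) (use l r fib_zero[OF pm_A r] in simp_all)
  then have "tr (partial_sum l A) r (translate n (2 * \<epsilon>) r) x - G (translate n \<epsilon> r) (F r x)
      \<in> single l ` ZA l (translate n (2 * \<epsilon>) r)"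
    using round_trip r x unfolding round_trip_modulo_def by blast
  ultimately have "tr (partial_sum l A) r (translate n (2 * \<epsilon>) r) x - G (translate n \<epsilon> r) (F r x) = 0"
    by auto
  then show "pm_comp (shift_hom n \<epsilon> G) F r x = shift_unit n (2 * \<epsilon>) (direct_sum A) r x"
    by (simp add: pm_comp_def shift_hom_def shift_unit_def)
qed

lemma direct_sum_hom:
  assumes F: "pm_hom n (partial_sum l A) (shift n \<epsilon> (partial_sum l B)) F"
    and l: "\<forall>i\<ge>l. \<forall>r\<in>carrier_vec n. fib (A i) r = {0}"
      "\<forall>i\<ge>l. \<forall>r\<in>carrier_vec n. fib (B i) r = {0}"
  shows "pm_hom n (direct_sum A) (shift n \<epsilon> (direct_sum B)) F"
proof (rule pm_hom_cong[OF F])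
  show "fib (direct_sum A) r = fib (partial_sum l A) r"
    and "fib (shift n \<epsilon> (direct_sum B)) r = fib (shift n \<epsilon> (partial_sum l B)) r"
    if "r \<in> carrier_vec n" for r
    using that l
    by (simp_all add: fib_direct_sum_eq_partial_sum[of _ _ l] fib_zero[OF pm_A] fib_zero[OF pm_B]
        del: direct_sum_simps(2) partial_sum_simps(3))
qed simp_all

lemma interleaved_direct_sums:
  assumes aA: "pm_hom n (A 0) M aA" and aB: "pm_hom n (B 0) N aB"
    and onto_A: "\<And>r. r \<in> carrier_vec n \<Longrightarrow> fib M r \<subseteq> aA r ` fib (A 0) r"
    and onto_B: "\<And>r. r \<in> carrier_vec n \<Longrightarrow> fib N r \<subseteq> aB r ` fib (B 0) r"
    and ZA: "\<And>r. r \<in> carrier_vec n \<Longrightarrow> ZA 0 r = {x \<in> fib (A 0) r. aA r x = 0}"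
    and ZB: "\<And>r. r \<in> carrier_vec n \<Longrightarrow> ZB 0 r = {x \<in> fib (B 0) r. aB r x = 0}"
    and MN: "interleaved n \<epsilon> M N"
    and l: "\<forall>i\<ge>l. \<forall>r\<in>carrier_vec n. fib (A i) r = {0}"
      "\<forall>i\<ge>l. \<forall>r\<in>carrier_vec n. fib (B i) r = {0}"
  shows "interleaved n \<epsilon> (direct_sum A) (direct_sum B)"
proof -
  interpret swapped: crossed_resolutions n \<epsilon> B A dB dA ZB ZA
    by (rule crossed_resolutions_swap) (rule crossed_resolutions_axioms)
  obtain f g where f: "pm_hom n M (shift n \<epsilon> N) f" and g: "pm_hom n N (shift n \<epsilon> M) g"
    and gf: "pm_eq n M (pm_comp (shift_hom n \<epsilon> g) f) (shift_unit n (2 * \<epsilon>) M)"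
    and fg: "pm_eq n N (pm_comp (shift_hom n \<epsilon> f) g) (shift_unit n (2 * \<epsilon>) N)"
    using MN unfolding interleaved_def by blast
  have ex_F0: "\<exists>F. pm_hom n (partial_sum 0 A) (shift n \<epsilon> (partial_sum 0 B)) F \<and>
    (\<forall>r\<in>carrier_vec n. \<forall>x\<in>fib (partial_sum 0 A) r.
      aB (translate n \<epsilon> r) (F r x 0) = f r (aA r (x 0)))"
    by (rule lift_to_first_summands[OF aA aB _ f]) (rule onto_B)
  have ex_G0: "\<exists>G. pm_hom n (partial_sum 0 B) (shift n \<epsilon> (partial_sum 0 A)) G \<and>
    (\<forall>r\<in>carrier_vec n. \<forall>y\<in>fib (partial_sum 0 B) r.
      aA (translate n \<epsilon> r) (G r y 0) = g r (aB r (y 0)))"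
    by (rule swapped.lift_to_first_summands[OF aB aA _ g]) (rule onto_A)
  obtain F0 where F0: "pm_hom n (partial_sum 0 A) (shift n \<epsilon> (partial_sum 0 B)) F0"
    "\<forall>r\<in>carrier_vec n. \<forall>x\<in>fib (partial_sum 0 A) r.
      aB (translate n \<epsilon> r) (F0 r x 0) = f r (aA r (x 0))"
    using ex_F0 by (elim exE conjE)
  obtain G0 where G0: "pm_hom n (partial_sum 0 B) (shift n \<epsilon> (partial_sum 0 A)) G0"
    "\<forall>r\<in>carrier_vec n. \<forall>y\<in>fib (partial_sum 0 B) r.
      aA (translate n \<epsilon> r) (G0 r y 0) = g r (aB r (y 0))"
    using ex_G0 by (elim exE conjE)
  have "round_trip_modulo n \<epsilon> A B ZA ZB 0 F0 G0"
    by (rule round_trip_first_summands[OF aA aB ZA ZB f gf F0(1) G0(1) F0(2) G0(2)])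
  moreover have "round_trip_modulo n \<epsilon> B A ZB ZA 0 G0 F0"
    by (rule swapped.round_trip_first_summands[OF aB aA ZB ZA g fg G0(1) F0(1) G0(2) F0(2)])
  ultimately have "\<exists>F G. round_trip_modulo n \<epsilon> A B ZA ZB 0 F G \<and> round_trip_modulo n \<epsilon> B A ZB ZA 0 G F"
    by (intro exI conjI)
  from interleaving_modulo_cycles[OF this, of l] obtain F G where FG: "round_trip_modulo n \<epsilon> A B ZA ZB l F G"
    and GF: "round_trip_modulo n \<epsilon> B A ZB ZA l G F" by (elim exE conjE)
  have F: "pm_hom n (direct_sum A) (shift n \<epsilon> (direct_sum B)) F"
    by (rule direct_sum_hom[OF _ l]) (use FG in \<open>simp add: round_trip_modulo_def\<close>)
  have G: "pm_hom n (direct_sum B) (shift n \<epsilon> (direct_sum A)) G"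
    by (rule swapped.direct_sum_hom[OF _ l(2,1)]) (use GF in \<open>simp add: round_trip_modulo_def\<close>)
  show ?thesis
    unfolding interleaved_def
    by (intro conjI exI[of _ F] exI[of _ G] F G pm_hom_dom[OF F] pm_hom_dom[OF G]
        shift_unit_direct_sum[OF FG l(1)] swapped.shift_unit_direct_sum[OF GF l(2)])
qed

end

section \<open>Crossing two projective resolutions\<close>

definition crossed ::
  "nat \<Rightarrow> real \<Rightarrow> (nat \<Rightarrow> ('k, 'v) persmod) \<Rightarrow> (nat \<Rightarrow> ('k, 'v) persmod) \<Rightarrow> nat \<Rightarrow> ('k, 'v) persmod" where
  "crossed n \<epsilon> P Q i = shift n (real i * \<epsilon>) (if even i then P i else Q i)"

text \<open>
  Parity is that of the target: for even \<open>i\<close>, the summand in degree \<open>i + 1\<close> comes from \<open>Q\<close>. The shift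
  is that of the source.
\<close>
definition crossed_differential ::
  "nat \<Rightarrow> real \<Rightarrow> (nat \<Rightarrow> real vec \<Rightarrow> 'v \<Rightarrow> 'v) \<Rightarrow> (nat \<Rightarrow> real vec \<Rightarrow> 'v \<Rightarrow> 'v) \<Rightarrow>
    nat \<Rightarrow> real vec \<Rightarrow> 'v \<Rightarrow> 'v" where
  "crossed_differential n \<epsilon> dP dQ i = shift_hom n (real (Suc i) * \<epsilon>) (if even i then dQ i else dP i)"

primrec crossed_cycles ::
  "nat \<Rightarrow> real \<Rightarrow> (nat \<Rightarrow> ('k, 'v::zero) persmod) \<Rightarrow> (nat \<Rightarrow> ('k, 'v) persmod) \<Rightarrow>
    (nat \<Rightarrow> real vec \<Rightarrow> 'v \<Rightarrow> 'v) \<Rightarrow> (nat \<Rightarrow> real vec \<Rightarrow> 'v \<Rightarrow> 'v) \<Rightarrow>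
    (real vec \<Rightarrow> 'v \<Rightarrow> 'a::zero) \<Rightarrow> nat \<Rightarrow> real vec \<Rightarrow> 'v set" where
  "crossed_cycles n \<epsilon> P Q dP dQ a 0 = (\<lambda>r. {x \<in> fib (crossed n \<epsilon> P Q 0) r. a r x = 0})"
| "crossed_cycles n \<epsilon> P Q dP dQ a (Suc i) =
    (\<lambda>r. {x \<in> fib (crossed n \<epsilon> P Q (Suc i)) r. crossed_differential n \<epsilon> dP dQ i r x = 0})"

lemma crossed_projective:
  assumes "projective_resolution n P dP aP M" "projective_resolution n Q dQ aQ N"
  shows "pm_projective n (crossed n \<epsilon> P Q i)"
  using assms by (simp add: crossed_def projective_resolution_def pm_projective_shift)

lemma crossed_differential_hom:
  assumes "projective_resolution n P dP aP M" "projective_resolution n Q dQ aQ N"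
  shows "pm_hom n (crossed n \<epsilon> P Q (Suc i)) (shift n \<epsilon> (crossed n \<epsilon> Q P i))
    (crossed_differential n \<epsilon> dP dQ i)"
proof -
  have "pm_hom n (P (Suc i)) (P i) (dP i)" "pm_hom n (Q (Suc i)) (Q i) (dQ i)"
    using assms by (simp_all add: projective_resolution_def)
  moreover have "\<epsilon> + real i * \<epsilon> = real (Suc i) * \<epsilon>" by (simp add: algebra_simps)
  ultimately show ?thesis
    unfolding crossed_def crossed_differential_def shift_shift by (auto intro: pm_hom_shift)
qed

lemma crossed_differential_image:
  assumes P: "projective_resolution n P dP aP M" and Q: "projective_resolution n Q dQ aQ N"
    and r: "r \<in> carrier_vec n"
  shows "crossed_differential n \<epsilon> dP dQ i r ` fib (crossed n \<epsilon> P Q (Suc i)) r =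
    crossed_cycles n \<epsilon> Q P dQ dP aQ i (translate n \<epsilon> r)"
proof (cases i)
  case 0
  have "dQ 0 (translate n \<epsilon> r) ` fib (Q 1) (translate n \<epsilon> r) =
      {x \<in> fib (Q 0) (translate n \<epsilon> r). aQ (translate n \<epsilon> r) x = 0}"
    using Q r by (simp add: projective_resolution_def)
  then show ?thesis using 0 r by (simp add: crossed_def crossed_differential_def shift_hom_def)
next
  case (Suc j)
  let ?R = "translate n (real (Suc (Suc j)) * \<epsilon>) r"
  have R: "translate n (real (Suc j) * \<epsilon>) (translate n \<epsilon> r) = ?R"
    by (simp add: algebra_simps)
  have "dP (Suc j) ?R ` fib (P (Suc (Suc j))) ?R = {x \<in> fib (P (Suc j)) ?R. dP j ?R x = 0}"
    and "dQ (Suc j) ?R ` fib (Q (Suc (Suc j))) ?R = {x \<in> fib (Q (Suc j)) ?R. dQ j ?R x = 0}"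
    using P Q r unfolding projective_resolution_def by (simp_all only: translate_carrier)
  then show ?thesis
    unfolding Suc crossed_cycles.simps crossed_def crossed_differential_def shift_hom_def
      shift_simps R by simp
qed

lemma crossed_augmentation:
  assumes "projective_resolution n P dP aP M"
  shows "pm_hom n (crossed n \<epsilon> P Q 0) M aP"
    and "r \<in> carrier_vec n \<Longrightarrow> fib M r \<subseteq> aP r ` fib (crossed n \<epsilon> P Q 0) r"
proof -
  have "pm_hom n (P 0) M aP" using assms by (simp add: projective_resolution_def)
  then show "pm_hom n (crossed n \<epsilon> P Q 0) M aP" by (rule pm_hom_cong) (simp_all add: crossed_def)
  show "fib M r \<subseteq> aP r ` fib (crossed n \<epsilon> P Q 0) r" if "r \<in> carrier_vec n"
    using assms that by (simp add: projective_resolution_def crossed_def)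
qed

lemma crossed_eventually_zero:
  assumes "finite_length n P" "finite_length n Q"
  shows "\<exists>l. \<forall>i\<ge>l. \<forall>r\<in>carrier_vec n.
    fib (crossed n \<epsilon> P Q i) r = {0} \<and> fib (crossed n \<epsilon> Q P i) r = {0}"
proof -
  obtain p q where "\<forall>m\<ge>p. \<forall>r\<in>carrier_vec n. fib (P m) r = {0}"
    "\<forall>m\<ge>q. \<forall>r\<in>carrier_vec n. fib (Q m) r = {0}"
    using assms by (auto simp: finite_length_def)
  then show ?thesis by (intro exI[of _ "max p q"]) (simp add: crossed_def)
qed

theorem proposition1p2:
  fixes n :: nat
    and M :: "('k::field, 'a::ab_group_add) persmod"
    and N :: "('k, 'b::ab_group_add) persmod"
    and P Q :: "nat \<Rightarrow> ('k, 'v::ab_group_add) persmod"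
    and dP dQ :: "nat \<Rightarrow> real vec \<Rightarrow> 'v \<Rightarrow> 'v"
    and aP :: "real vec \<Rightarrow> 'v \<Rightarrow> 'a"
    and aQ :: "real vec \<Rightarrow> 'v \<Rightarrow> 'b"
    and \<epsilon> :: real
  assumes "persistence_module n M"
    and "persistence_module n N"
    and "projective_resolution n P dP aP M"
    and "finite_length n P"
    and "projective_resolution n Q dQ aQ N"
    and "finite_length n Q"
    and "\<epsilon> \<ge> 0"
    and "interleaved n \<epsilon> M N"
  shows "interleaved n \<epsilon>
    (direct_sum (\<lambda>i. shift n (real i * \<epsilon>) (if even i then P i else Q i)))
    (direct_sum (\<lambda>i. shift n (real i * \<epsilon>) (if even i then Q i else P i)))"
proof -
  note P = assms(3) and Q = assms(5)
  interpret crossed_resolutions n \<epsilon> "crossed n \<epsilon> P Q" "crossed n \<epsilon> Q P"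
    "crossed_differential n \<epsilon> dP dQ" "crossed_differential n \<epsilon> dQ dP"
    "crossed_cycles n \<epsilon> P Q dP dQ aP" "crossed_cycles n \<epsilon> Q P dQ dP aQ"
    by unfold_locales
      (simp_all add: assms(7) crossed_projective[OF P Q] crossed_projective[OF Q P]
        crossed_differential_hom[OF P Q] crossed_differential_hom[OF Q P]
        crossed_differential_image[OF P Q] crossed_differential_image[OF Q P])
  obtain l where l: "\<forall>i\<ge>l. \<forall>r\<in>carrier_vec n.
    fib (crossed n \<epsilon> P Q i) r = {0} \<and> fib (crossed n \<epsilon> Q P i) r = {0}"
    using crossed_eventually_zero[OF assms(4,6)] by blast
  have "interleaved n \<epsilon> (direct_sum (crossed n \<epsilon> P Q)) (direct_sum (crossed n \<epsilon> Q P))"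
    by (rule interleaved_direct_sums[of M aP N aQ l])
      (use l assms(8) crossed_augmentation[OF P] crossed_augmentation[OF Q] in simp_all)
  then show ?thesis by (simp only: crossed_def[abs_def])
qed

end
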